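(* Assume $H\in(\tfrac12,1)$, $\alpha>0$ and $\alpha+2H>2$, and let $\phi$, $\psi$, $\mathrm{Tr}^j$ and $|\mathcal H|^{\otimes n}$ be as in the context. Then for all $m,k\in\mathbb N_0$ and $j=0,1,\dots,\lfloor m/2\rfloor$, $\mathrm{Tr}^j\psi_{m,k}\in|\mathcal H|^{\otimes(m-2j)}$. Moreover, $$\|\mathrm{Tr}^j\psi_{m,k}\|^2_{|\mathcal H|^{\otimes(m-2j)}}\le\|\mathrm{Tr}^j\phi_{m+k}\|^2_{|\mathcal H|^{\otimes(m+k-2j)}}.$$
   Context: $\mathbb N_0=\{0,1,2,\dots\}$. $\tau_1$ is an $\mathbb N$-valued random variable ($\mathbb N=\{1,2,\dots\}$) with $\mathbb P(\tau_1=n)=L(n)/n^{1+\alpha}$, $n\ge1$, where $L:(0,\infty)\to(0,\infty)$ is slowly varying ($\lim_{t\to\infty}L(at)/L(t)=1$ for every $a>0$). $\phi_k$ is the symmetric function on $(0,1)^k$ that equals $0$ if two coordinates coincide, and for $0<t_1<\dots<t_k<1$ (with $t_0:=0$): $\phi_k=C_\alpha^k\prod_{i=1}^k(t_i-t_{i-1})^{\alpha-1}$ with $C_\alpha=\alpha\sin(\pi\alpha)/\pi$ if $1-H<\alpha<1$; $\phi_k=(1/\mathbb E[\tau_1])^k$ if $\mathbb E[\tau_1]<\infty$; $\phi_k=1$ if $\alpha=1$ and $\mathbb E[\tau_1]=\infty$; $\phi_0:=1$. $\psi_{m,k}(t_1,\dots,t_m):=\int_{[0,1]^k}\phi_{m+k}(t_1,\dots,t_{m+k})\,\mathrm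 dt_{m+1}\cdots\mathrm dt_{m+k}$. For $f$ on $[0,1]^n$ and $0\le j\le\lfloor n/2\rfloor$, the $j$-th order trace is $$\mathrm{Tr}^jf(t_1,\dots,t_{n-2j}):=\int_{[0,1]^{2j}}f(s_1,\dots,s_{2j},t_1,\dots,t_{n-2j})\prod_{i=1}^j|s_{2i}-s_{2i-1}|^{2H-2}\,\mathrm d\boldsymbol s.$$ $|\mathcal H|^{\otimes n}$ is the space of measurable functions $f$ on $[0,1]^n$ with $$\|f\|^2_{|\mathcal H|^{\otimes n}}:=\int_{[0,1]^{2n}}|f(s_1,\dots,s_n)f(t_1,\dots,t_n)|\prod_{i=1}^n|s_i-t_i|^{2H-2}\,\mathrm d\boldsymbol s\,\mathrm d\boldsymbol t<\infty;$$ for $n=0$ it is $\mathbb R$ with the absolute value as norm. *)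

theory Defs
  imports "HOL-Probability.Probability"
begin

definition slowly_varying :: "(real \<Rightarrow> real) \<Rightarrow> bool" where
  "slowly_varying L \<longleftrightarrow> (\<forall>a>0. ((\<lambda>t. L (a * t) / L t) \<longlongrightarrow> 1) at_top)"

text \<open>
  Lebesgue measure on \<open>[0,1]^n\<close>. A point \<open>(t_1, ..., t_n)\<close> is an extensional function on
  \<open>{..<n}\<close>, so coordinate \<open>t_i\<close> is \<open>t (i - 1)\<close>. For \<open>n = 0\<close> this is the point mass at the
  empty tuple, and functions on it are identified with constants.
\<close>
definition cube :: "nat \<Rightarrow> (nat \<Rightarrow> real) measure" where
  "cube n = Pi\<^sub>M {..<n} (\<lambda>_. restrict_space lborel {0..1})"

text \<open>Concatenation of an \<open>n\<close>-tuple \<open>s\<close> with a tuple \<open>t\<close>.\<close>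
definition concat_pt :: "nat \<Rightarrow> (nat \<Rightarrow> real) \<Rightarrow> (nat \<Rightarrow> real) \<Rightarrow> nat \<Rightarrow> real" where
  "concat_pt n s t = (\<lambda>i. if i < n then s i else t (i - n))"

text \<open>
  The function \<open>\<phi>\<^sub>k\<close>, extended by \<open>0\<close> from \<open>(0,1)^k\<close> to the boundary of the cube (a null set).
  Symmetry is built in by evaluating at the increasing rearrangement \<open>s\<close> of the coordinates.
  The variable \<open>\<tau>\<close> on the probability space \<open>M\<close> enters only through its mean.
\<close>
definition phi ::
  "real \<Rightarrow> real \<Rightarrow> 'w measure \<Rightarrow> ('w \<Rightarrow> nat) \<Rightarrow> nat \<Rightarrow> (nat \<Rightarrow> real) \<Rightarrow> real" where
  "phi H \<alpha> M \<tau> k t =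
    (if k = 0 then 1
     else if \<not> (\<forall>i<k. t i \<in> {0<..<1}) \<or> \<not> inj_on t {..<k} then 0
     else if 1 - H < \<alpha> \<and> \<alpha> < 1 then
       (let s = sort (map t [0..<k])
        in (\<alpha> * sin (pi * \<alpha>) / pi) ^ k *
           (\<Prod>i<k. (s ! i - (if i = 0 then 0 else s ! (i - 1))) powr (\<alpha> - 1)))
     else if integrable M (\<lambda>\<omega>. real (\<tau> \<omega>)) then (1 / (\<integral>\<omega>. real (\<tau> \<omega>) \<partial>M)) ^ k
     else if \<alpha> = 1 then 1
     else undefined)"

definition psi ::
  "real \<Rightarrow> real \<Rightarrow> 'w measure \<Rightarrow> ('w \<Rightarrow> nat) \<Rightarrow> nat \<Rightarrow> nat \<Rightarrow> (nat \<Rightarrow> real) \<Rightarrow> real" where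
  "psi H \<alpha> M \<tau> m k t = (\<integral>u. phi H \<alpha> M \<tau> (m + k) (concat_pt m t u) \<partial>cube k)"

text \<open>
  The Bochner integral takes the junk value \<open>0\<close> when it does not converge; the predicates
  \<open>psi_converges\<close> and \<open>Tr_converges\<close> say that the integrals defining \<open>psi\<close> and \<open>Tr\<close> converge
  absolutely at almost every point.
\<close>
definition psi_converges ::
  "real \<Rightarrow> real \<Rightarrow> 'w measure \<Rightarrow> ('w \<Rightarrow> nat) \<Rightarrow> nat \<Rightarrow> nat \<Rightarrow> bool" where
  "psi_converges H \<alpha> M \<tau> m k \<longleftrightarrow>
    (AE t in cube m. integrable (cube k) (\<lambda>u. phi H \<alpha> M \<tau> (m + k) (concat_pt m t u)))"

text \<open>
  Here and in \<open>absH_norm_sq\<close>, \<open>0 powr (2 * H - 2) = 0\<close> replaces the singular value of the kernel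
  on the diagonals, which are null sets.
\<close>
definition Tr_integrand ::
  "real \<Rightarrow> nat \<Rightarrow> ((nat \<Rightarrow> real) \<Rightarrow> real) \<Rightarrow> (nat \<Rightarrow> real) \<Rightarrow> (nat \<Rightarrow> real) \<Rightarrow> real" where
  "Tr_integrand H j f t s =
    f (concat_pt (2 * j) s t) * (\<Prod>i<j. \<bar>s (2 * i + 1) - s (2 * i)\<bar> powr (2 * H - 2))"

definition Tr :: "real \<Rightarrow> nat \<Rightarrow> ((nat \<Rightarrow> real) \<Rightarrow> real) \<Rightarrow> (nat \<Rightarrow> real) \<Rightarrow> real" where
  "Tr H j f t = (\<integral>s. Tr_integrand H j f t s \<partial>cube (2 * j))"

text \<open>Here \<open>n\<close> is the number of arguments of \<open>f\<close>.\<close>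
definition Tr_converges :: "real \<Rightarrow> nat \<Rightarrow> nat \<Rightarrow> ((nat \<Rightarrow> real) \<Rightarrow> real) \<Rightarrow> bool" where
  "Tr_converges H n j f \<longleftrightarrow>
    (AE t in cube (n - 2 * j). integrable (cube (2 * j)) (Tr_integrand H j f t))"

definition absH_norm_sq :: "real \<Rightarrow> nat \<Rightarrow> ((nat \<Rightarrow> real) \<Rightarrow> real) \<Rightarrow> ennreal" where
  "absH_norm_sq H n f =
    (\<integral>\<^sup>+ (s, t). ennreal (\<bar>f s * f t\<bar> * (\<Prod>i<n. \<bar>s i - t i\<bar> powr (2 * H - 2)))
       \<partial>(cube n \<Otimes>\<^sub>M cube n))"

definition absH :: "real \<Rightarrow> nat \<Rightarrow> ((nat \<Rightarrow> real) \<Rightarrow> real) set" where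
  "absH H n = {f \<in> borel_measurable (cube n). absH_norm_sq H n f < \<infinity>}"

end

theory Submission
  imports Defs
begin

text \<open>
  Write \<open>\<beta>\<close> for \<open>1 - \<alpha>\<close> (or \<open>0\<close> if \<open>\<alpha> \<ge> 1\<close>) and \<open>\<gamma> = 2 - 2 * H\<close>, so that \<open>\<beta> + \<gamma> < 1\<close>. The squared norm of
  a trace of \<open>phi\<close> is an integral over two chains of points, each point carrying the power \<open>- \<beta>\<close> of
  its distance to its predecessor in its own chain, and over a perfect matching of all the points
  with kernel \<open>\<bar>x - y\<bar> powr - \<gamma>\<close>. Charge every matching kernel to the larger of its two points: then
  each point carries at most the power \<open>- (\<beta> + \<gamma>)\<close> of its distance to the nearest smaller point, and
  such a product is integrable, by integrating out the largest point first.

  The norm inequality follows from Fubini's theorem, as \<open>Tr H j psi\<close> is obtained from \<open>Tr H j phi\<close> by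
  integrating out \<open>k\<close> variables, and the kernel \<open>\<bar>x - y\<bar> powr - \<gamma>\<close> is at least \<open>1\<close> on the unit cube.
\<close>

section \<open>The unit cube\<close>

definition unit_leb :: "real measure" where
  "unit_leb = restrict_space lborel {0..1}"

lemma cube_eq: "cube n = Pi\<^sub>M {..<n} (\<lambda>_. unit_leb)"
  by (simp add: cube_def unit_leb_def)

lemma space_unit_leb [simp]: "space unit_leb = {0..1}"
  by (simp add: unit_leb_def space_restrict_space)

lemma prob_space_unit_leb: "prob_space unit_leb"
  by (auto intro!: prob_spaceI simp: unit_leb_def space_restrict_space emeasure_restrict_space)

text \<open>The index set is all of \<open>nat\<close>, so that every finite index set is covered;
  besides \<open>{..<n}\<close>, the sets \<open>I - {a}\<close> occur below.\<close>

interpretation unit_prod: product_prob_space "\<lambda>_::nat. unit_leb" UNIV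
  by (intro product_prob_spaceI prob_space_unit_leb)

interpretation cube: prob_space "cube n" for n
  unfolding cube_eq by (intro prob_space_PiM prob_space_unit_leb)

interpretation cube_pair: pair_sigma_finite "cube n" "cube k" for n k ..

lemma space_cube: "space (cube n) = {..<n} \<rightarrow>\<^sub>E {0..1}"
  by (simp add: cube_eq space_PiM)

lemma borel_measurable_unit_leb: "f \<in> borel_measurable borel \<Longrightarrow> f \<in> borel_measurable unit_leb"
  unfolding unit_leb_def by (rule measurable_restrict_space1) simp

lemma measurable_coord_PiM_unit:
  assumes "i \<in> I" shows "(\<lambda>x. x i) \<in> borel_measurable (Pi\<^sub>M I (\<lambda>_. unit_leb))"
  using measurable_compose[OF measurable_component_singleton[OF assms] borel_measurable_unit_leb[of "\<lambda>x. x"]]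
  by simp

lemma measurable_coord_cube: "i < n \<Longrightarrow> (\<lambda>x. x i) \<in> borel_measurable (cube n)"
  unfolding cube_eq by (rule measurable_coord_PiM_unit) simp

lemma AE_unit_leb_neq: "AE y in unit_leb. y \<noteq> c"
  unfolding unit_leb_def by (subst AE_restrict_space_iff) (auto simp: AE_lborel_singleton intro: AE_mp[OF AE_lborel_singleton[of c]])

section \<open>Concatenation of tuples and Tonelli's theorem on cubes\<close>

lemma concat_pt_in_space_cube:
  "s \<in> space (cube n) \<Longrightarrow> t \<in> space (cube k) \<Longrightarrow> concat_pt n s t \<in> space (cube (n + k))"
  by (auto simp: space_cube concat_pt_def PiE_iff extensional_def)

lemma measurable_concat_pt [measurable]:
  "(\<lambda>(s, t). concat_pt n s t) \<in> measurable (cube n \<Otimes>\<^sub>M cube k) (cube (n + k))"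
proof -
  have "(\<lambda>z i. concat_pt n (fst z) (snd z) i) \<in> measurable (cube n \<Otimes>\<^sub>M cube k) (Pi\<^sub>M {..<n + k} (\<lambda>_. unit_leb))"
  proof (rule measurable_PiM_single')
    fix i assume i: "i \<in> {..<n + k}"
    show "(\<lambda>z. concat_pt n (fst z) (snd z) i) \<in> measurable (cube n \<Otimes>\<^sub>M cube k) unit_leb"
    proof (cases "i < n")
      case True
      then have [measurable]: "(\<lambda>x. x i) \<in> measurable (cube n) unit_leb"
        unfolding cube_eq by simp
      show ?thesis using True by (simp add: concat_pt_def)
    next
      case False
      then have [measurable]: "(\<lambda>x. x (i - n)) \<in> measurable (cube k) unit_leb"
        unfolding cube_eq using i by (intro measurable_component_singleton) auto
      show ?thesis using False by (simp add: concat_pt_def)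
    qed
  next
    show "(\<lambda>z i. concat_pt n (fst z) (snd z) i) \<in> space (cube n \<Otimes>\<^sub>M cube k) \<rightarrow> ({..<n + k} \<rightarrow>\<^sub>E space unit_leb)"
    proof (rule Pi_I)
      fix z assume "z \<in> space (cube n \<Otimes>\<^sub>M cube k)"
      then show "(\<lambda>i. concat_pt n (fst z) (snd z) i) \<in> ({..<n + k} \<rightarrow>\<^sub>E space unit_leb)"
        using concat_pt_in_space_cube[of "fst z" n "snd z" k]
        by (simp add: space_pair_measure space_cube mem_Times_iff)
    qed
  qed
  then show ?thesis by (simp add: cube_eq case_prod_beta')
qed

lemma measurable_concat_pt' [measurable (raw)]:
  assumes "f \<in> measurable N (cube n)" "g \<in> measurable N (cube k)"
  shows "(\<lambda>x. concat_pt n (f x) (g x)) \<in> measurable N (cube (n + k))"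
  using measurable_compose[OF measurable_Pair[OF assms] measurable_concat_pt] by simp

text \<open>A product measure is determined by its values on boxes, and the preimage of a box under
  concatenation is a product of two boxes.\<close>

lemma distr_concat_pt:
  "distr (cube n \<Otimes>\<^sub>M cube k) (cube (n + k)) (\<lambda>(s, t). concat_pt n s t) = cube (n + k)"
  (is "?D = _")
proof -
  have "?D = Pi\<^sub>M {..<n + k} (\<lambda>_. unit_leb)"
  proof (rule unit_prod.PiM_eqI)
    fix A :: "nat \<Rightarrow> real set"
    assume A: "\<And>i. i \<in> {..<n + k} \<Longrightarrow> A i \<in> sets unit_leb"
    have A': "A i \<subseteq> {0..1}" if "i < n + k" for i
      using sets.sets_into_space[OF A[of i]] that by simp
    have 1: "Pi\<^sub>E {..<n + k} A \<in> sets (cube (n + k))"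
      unfolding cube_eq using A by (intro sets_PiM_I_finite) auto
    have s1: "Pi\<^sub>E {..<n} A \<in> sets (cube n)"
      unfolding cube_eq using A by (intro sets_PiM_I_finite) auto
    have s2: "Pi\<^sub>E {..<k} (\<lambda>i. A (n + i)) \<in> sets (cube k)"
      unfolding cube_eq using A by (intro sets_PiM_I_finite) auto
    have *: "(\<lambda>(s, t). concat_pt n s t) -` Pi\<^sub>E {..<n + k} A \<inter> space (cube n \<Otimes>\<^sub>M cube k)
        = Pi\<^sub>E {..<n} A \<times> Pi\<^sub>E {..<k} (\<lambda>i. A (n + i))" (is "?L = ?R")
    proof (rule set_eqI)
      fix z :: "(nat \<Rightarrow> real) \<times> (nat \<Rightarrow> real)"
      obtain s t where z: "z = (s, t)" by fastforce
      have in_A: "(\<forall>i<n + k. concat_pt n s t i \<in> A i) \<longleftrightarrow> (\<forall>i<n. s i \<in> A i) \<and> (\<forall>i<k. t i \<in> A (n + i))"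
      proof (intro iffI conjI allI impI)
        fix i assume *: "\<forall>i<n + k. concat_pt n s t i \<in> A i"
        { assume "i < n" then show "s i \<in> A i" using *[rule_format, of i] by (simp add: concat_pt_def) }
        { assume "i < k" then show "t i \<in> A (n + i)" using *[rule_format, of "n + i"] by (simp add: concat_pt_def) }
      next
        fix i assume *: "(\<forall>i<n. s i \<in> A i) \<and> (\<forall>i<k. t i \<in> A (n + i))" "i < n + k"
        show "concat_pt n s t i \<in> A i"
        proof (cases "i < n")
          case False
          then have "i - n < k" "n + (i - n) = i" using *(2) by auto
          then show ?thesis using conjunct2[OF *(1), rule_format, of "i - n"] False by (simp add: concat_pt_def)
        qed (use * in \<open>simp add: concat_pt_def\<close>)
      qed
      have cube: "s \<in> space (cube n) \<and> t \<in> space (cube k)" if "z \<in> ?R"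
      proof -
        have "s i \<in> {0..1}" if "i < n" for i
          using \<open>z \<in> ?R\<close> that A'[of i] unfolding z by (auto simp: PiE_iff)
        moreover have "t i \<in> {0..1}" if "i < k" for i
          using \<open>z \<in> ?R\<close> that A'[of "n + i"] unfolding z by (auto simp: PiE_iff)
        ultimately show ?thesis using that unfolding z space_cube by (simp add: PiE_iff)
      qed
      show "z \<in> ?L \<longleftrightarrow> z \<in> ?R"
      proof
        assume "z \<in> ?L"
        then show "z \<in> ?R" using in_A
          by (simp add: z space_pair_measure space_cube PiE_iff)
      next
        assume R: "z \<in> ?R"
        show "z \<in> ?L" using R in_A cube[OF R] concat_pt_in_space_cube[of s n t k]
          by (simp add: z space_pair_measure space_cube PiE_iff)
      qed
    qed
    have "emeasure ?D (Pi\<^sub>E {..<n + k} A) = emeasure (cube n) (Pi\<^sub>E {..<n} A) * emeasure (cube k) (Pi\<^sub>E {..<k} (\<lambda>i. A (n + i)))"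
      using 1 s1 s2 by (subst emeasure_distr) (auto simp: * cube.emeasure_pair_measure_Times)
    also have "\<dots> = (\<Prod>i<n. emeasure unit_leb (A i)) * (\<Prod>i<k. emeasure unit_leb (A (n + i)))"
      unfolding cube_eq using A by (subst (1 2) unit_prod.emeasure_PiM) auto
    also have "\<dots> = (\<Prod>i<n + k. emeasure unit_leb (A i))"
      by (induction k) (simp_all add: mult.assoc [symmetric])
    finally show "emeasure ?D (Pi\<^sub>E {..<n + k} A) = (\<Prod>i\<in>{..<n + k}. emeasure unit_leb (A i))" .
  qed (simp_all add: cube_eq)
  then show ?thesis by (simp add: cube_eq)
qed

text \<open>Tonelli's theorem after transport along \<open>concat_pt\<close>. It serves to split off
  variables and to merge nested integrals into one over a larger cube.\<close>

lemma nn_integral_cube_add: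
  assumes h: "h \<in> borel_measurable (cube (n + k))"
  shows "(\<integral>\<^sup>+x. h x \<partial>cube (n + k)) = (\<integral>\<^sup>+s. \<integral>\<^sup>+t. h (concat_pt n s t) \<partial>cube k \<partial>cube n)"
proof -
  note h[measurable]
  have "(\<integral>\<^sup>+x. h x \<partial>cube (n + k)) = (\<integral>\<^sup>+x. h x \<partial>distr (cube n \<Otimes>\<^sub>M cube k) (cube (n + k)) (\<lambda>(s, t). concat_pt n s t))"
    by (simp add: distr_concat_pt)
  also have "\<dots> = (\<integral>\<^sup>+z. h (case z of (s, t) \<Rightarrow> concat_pt n s t) \<partial>(cube n \<Otimes>\<^sub>M cube k))"
    by (rule nn_integral_distr) measurable
  also have "\<dots> = (\<integral>\<^sup>+s. \<integral>\<^sup>+t. h (concat_pt n s t) \<partial>cube k \<partial>cube n)"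
    by (subst cube.nn_integral_fst[symmetric]) simp_all
  finally show ?thesis .
qed

section \<open>Integrability of products of gap powers\<close>

text \<open>The bound must be uniform in \<open>c\<close>. On the unit interval the integrand is
  dominated by a translate and a reflection of \<open>f\<close>, each with integral
  \<open>1 / (1 - \<delta>)\<close>.\<close>

lemma nn_integral_unit_powr_le:
  fixes c \<delta> :: real
  assumes "0 \<le> c" "c \<le> 1" "0 \<le> \<delta>" "\<delta> < 1"
  shows "(\<integral>\<^sup>+y. ennreal (\<bar>y - c\<bar> powr - \<delta>) \<partial>unit_leb) \<le> ennreal (2 / (1 - \<delta>))"
proof -
  define f :: "real \<Rightarrow> ennreal" where "f = (\<lambda>y. ennreal (y powr - \<delta>) * indicator {0..1} y)"
  have [measurable]: "f \<in> borel_measurable borel" unfolding f_def by measurable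
  have "((\<lambda>x. x powr - \<delta>) has_integral (1 powr (- \<delta> + 1) / (- \<delta> + 1))) {0..1}"
    using assms by (intro has_integral_powr_from_0) auto
  then have f: "(\<integral>\<^sup>+y. f y \<partial>lborel) = ennreal (1 / (1 - \<delta>))"
    unfolding f_def by (intro nn_integral_has_integral_lebesgue') auto
  have "(\<integral>\<^sup>+y. ennreal (\<bar>y - c\<bar> powr - \<delta>) \<partial>unit_leb)
      = (\<integral>\<^sup>+y. ennreal (\<bar>y - c\<bar> powr - \<delta>) * indicator {0..1} y \<partial>lborel)"
    unfolding unit_leb_def by (rule nn_integral_restrict_space) simp
  also have "\<dots> \<le> (\<integral>\<^sup>+y. f (- c + 1 * y) + f (c + (- 1) * y) \<partial>lborel)"
    using assms by (intro nn_integral_mono) (auto simp: f_def indicator_def abs_if)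
  also have "\<dots> = (\<integral>\<^sup>+y. f (- c + 1 * y) \<partial>lborel) + (\<integral>\<^sup>+y. f (c + (- 1) * y) \<partial>lborel)"
    by (rule nn_integral_add) measurable
  also have "(\<integral>\<^sup>+y. f (- c + 1 * y) \<partial>lborel) = (\<integral>\<^sup>+y. f y \<partial>lborel)"
    by (subst (2) nn_integral_real_affine[where c = 1 and t = "- c"]) simp_all
  also have "(\<integral>\<^sup>+y. f (c + (- 1) * y) \<partial>lborel) = (\<integral>\<^sup>+y. f y \<partial>lborel)"
    by (subst (2) nn_integral_real_affine[where c = "- 1" and t = c]) simp_all
  finally show ?thesis using assms by (simp add: f ennreal_plus[symmetric] del: ennreal_plus)
qed

text \<open>
  Up to the number of terms, this is the power \<open>- \<delta>\<close> of the distance from \<open>x a\<close> to the nearest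
  smaller value among \<open>0\<close> and the coordinates of \<open>x\<close>.
\<close>
definition gap_weight :: "real \<Rightarrow> nat set \<Rightarrow> (nat \<Rightarrow> real) \<Rightarrow> nat \<Rightarrow> real" where
  "gap_weight \<delta> I x a = x a powr - \<delta> + (\<Sum>b\<in>I. if x b < x a then (x a - x b) powr - \<delta> else 0)"

lemma gap_weight_nonneg: "0 \<le> gap_weight \<delta> I x a"
  unfolding gap_weight_def by (intro add_nonneg_nonneg sum_nonneg) auto

lemma borel_measurable_gap_weight:
  assumes "finite I" "I \<subseteq> J" "a \<in> J"
  shows "(\<lambda>x. gap_weight \<delta> I x a) \<in> borel_measurable (Pi\<^sub>M J (\<lambda>_. unit_leb))"
proof -
  have [measurable]: "(\<lambda>x. x i) \<in> borel_measurable (Pi\<^sub>M J (\<lambda>_. unit_leb))" if "i \<in> J" for i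
    using that by (rule measurable_coord_PiM_unit)
  show ?thesis unfolding gap_weight_def using assms
    by (intro borel_measurable_add borel_measurable_sum) (auto intro!: measurable_If dest: subsetD)
qed

text \<open>
  Removing a largest coordinate \<open>a\<close> leaves the weights of the other coordinates unchanged, so the
  product over \<open>I\<close> is bounded by a sum over the candidates for \<open>a\<close>.
\<close>
lemma prod_gap_weight_le:
  assumes "finite I" "I \<noteq> {}"
  shows "(\<Prod>a\<in>I. gap_weight \<delta> I x a) \<le>
    (\<Sum>a\<in>I. (\<Prod>b\<in>I - {a}. gap_weight \<delta> (I - {a}) x b) *
       (x a powr - \<delta> + (\<Sum>b\<in>I - {a}. \<bar>x a - x b\<bar> powr - \<delta>)))" (is "_ \<le> (\<Sum>a\<in>I. ?t a)")
proof -
  obtain a where a: "a \<in> I" "\<And>b. b \<in> I \<Longrightarrow> x b \<le> x a"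
    using Max_in[of "x ` I"] Max_ge[of "x ` I"] assms by (metis (no_types, lifting) finite_imageI image_iff image_is_empty)
  \<comment> \<open>Weights see only strictly smaller values, so a largest coordinate contributes
    zero to every weight, even in the presence of ties.\<close>
  have rest: "gap_weight \<delta> I x b = gap_weight \<delta> (I - {a}) x b" if "b \<in> I" for b
    using a that assms(1) by (auto simp: gap_weight_def sum.remove[of I a] not_less)
  \<comment> \<open>With absolute values in place of the order condition, the factor of
    \<open>a\<close> can be integrated over the whole unit interval.\<close>
  have top: "gap_weight \<delta> I x a \<le> x a powr - \<delta> + (\<Sum>b\<in>I - {a}. \<bar>x a - x b\<bar> powr - \<delta>)"
    unfolding rest[OF a(1)] unfolding gap_weight_def by (intro add_left_mono sum_mono) auto
  have "(\<Prod>b\<in>I. gap_weight \<delta> I x b) = (\<Prod>b\<in>I - {a}. gap_weight \<delta> (I - {a}) x b) * gap_weight \<delta> I x a"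
    using assms a rest by (subst prod.remove[of I a]) (simp_all add: mult.commute)
  also have "\<dots> \<le> ?t a"
    using top by (intro mult_left_mono prod_nonneg ballI gap_weight_nonneg)
  also have "\<dots> \<le> (\<Sum>a\<in>I. ?t a)"
    using a(1) assms(1) by (intro member_le_sum mult_nonneg_nonneg prod_nonneg ballI gap_weight_nonneg add_nonneg_nonneg sum_nonneg) auto
  finally show ?thesis .
qed

text \<open>Induction on the number of coordinates. In each summand of
  \<open>prod_gap_weight_le\<close>, coordinate \<open>a\<close> is integrated first; its factor has
  an integral bounded uniformly in the others, and what remains is the product over
  \<open>I - {a}\<close>.\<close>

lemma nn_integral_prod_gap_weight_finite:
  assumes "finite I" "0 \<le> \<delta>" "\<delta> < 1"
  shows "(\<integral>\<^sup>+x. ennreal (\<Prod>a\<in>I. gap_weight \<delta> I x a) \<partial>Pi\<^sub>M I (\<lambda>_. unit_leb)) < \<infinity>"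
  using assms(1)
proof (induction "card I" arbitrary: I)
  case 0
  then show ?case by (simp add: PiM_empty)
next
  case (Suc p)
  let ?U = "\<lambda>I. Pi\<^sub>M I (\<lambda>_::nat. unit_leb)"
  let ?K = "ennreal (2 / (1 - \<delta>))"
  have fin: "finite I" and ne: "I \<noteq> {}" using Suc by auto
  define P where "P a x = (\<Prod>b\<in>I - {a}. gap_weight \<delta> (I - {a}) x b)" for a x
  define V where "V a x y = (y powr - \<delta> + (\<Sum>b\<in>I - {a}. \<bar>y - x b\<bar> powr - \<delta>))" for a x and y :: real
  have P0: "0 \<le> P a x" for a x unfolding P_def by (intro prod_nonneg ballI gap_weight_nonneg)
  have V0: "0 \<le> V a x y" for a x y unfolding V_def by (intro add_nonneg_nonneg sum_nonneg) auto
  have mP: "P a \<in> borel_measurable (?U J)" if "I - {a} \<subseteq> J" for a J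
    unfolding P_def using fin that by (intro borel_measurable_prod borel_measurable_gap_weight) auto
  have coord [measurable]: "(\<lambda>x. x i) \<in> borel_measurable (?U I)" if "i \<in> I" for i
    using that by (rule measurable_coord_PiM_unit)
  have mV: "(\<lambda>x. V a x (x a)) \<in> borel_measurable (?U I)" if "a \<in> I" for a
    unfolding V_def using that by (intro borel_measurable_add borel_measurable_sum powr_real_measurable
      borel_measurable_abs borel_measurable_diff coord) auto
  have step: "(\<integral>\<^sup>+x. ennreal (P a x * V a x (x a)) \<partial>?U I) < \<infinity>" if a: "a \<in> I" for a
  proof -
    have mf: "(\<lambda>x. ennreal (P a x * V a x (x a))) \<in> borel_measurable (?U I)"
      using mP[of a I] mV[OF a] by (intro measurable_compose[OF _ measurable_ennreal] borel_measurable_times) auto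
    have I: "I = insert a (I - {a})" using a by auto
    have "(\<integral>\<^sup>+x. ennreal (P a x * V a x (x a)) \<partial>?U I)
        = (\<integral>\<^sup>+x. \<integral>\<^sup>+y. ennreal (P a (x(a := y)) * V a (x(a := y)) y) \<partial>unit_leb \<partial>?U (I - {a}))"
      using unit_prod.product_nn_integral_insert[of "I - {a}" a "\<lambda>x. ennreal (P a x * V a x (x a))"]
        mf fin a by (simp add: insert_absorb)
    also have "\<dots> = (\<integral>\<^sup>+x. \<integral>\<^sup>+y. ennreal (P a x) * ennreal (V a x y) \<partial>unit_leb \<partial>?U (I - {a}))"
    proof (intro nn_integral_cong)
      fix x and y :: real
      \<comment> \<open>Neither \<open>P a\<close> nor the sum in \<open>V a\<close> reads
        coordinate \<open>a\<close>, so the integrand factorises.\<close>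
      have "P a (x(a := y)) = P a x" unfolding P_def gap_weight_def
        by (intro prod.cong refl arg_cong2[where f = "(+)"] sum.cong) auto
      moreover have "V a (x(a := y)) y = V a x y"
        unfolding V_def by (intro arg_cong2[where f = "(+)"] sum.cong) auto
      ultimately show "ennreal (P a (x(a := y)) * V a (x(a := y)) y) = ennreal (P a x) * ennreal (V a x y)"
        by (simp add: ennreal_mult P0 V0)
    qed
    also have "\<dots> \<le> (\<integral>\<^sup>+x. ennreal (P a x) * (of_nat (Suc p) * ?K) \<partial>?U (I - {a}))"
    proof (rule nn_integral_mono)
      fix x assume "x \<in> space (?U (I - {a}))"
      then have x: "x b \<in> {0..1}" if "b \<in> I - {a}" for b using that by (auto simp: space_PiM PiE_iff)
      have m: "(\<lambda>y. ennreal (\<bar>y - c\<bar> powr - \<delta>)) \<in> borel_measurable unit_leb" for c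
        by (rule borel_measurable_unit_leb) measurable
      have m': "(\<lambda>y. ennreal (V a x y)) \<in> borel_measurable unit_leb"
        unfolding V_def by (rule borel_measurable_unit_leb) measurable
      have "(\<integral>\<^sup>+y. ennreal (V a x y) \<partial>unit_leb) =
          (\<integral>\<^sup>+y. ennreal (\<bar>y - 0\<bar> powr - \<delta>) + (\<Sum>b\<in>I - {a}. ennreal (\<bar>y - x b\<bar> powr - \<delta>)) \<partial>unit_leb)"
        unfolding V_def by (intro nn_integral_cong) (auto simp: sum_nonneg)
      also have "\<dots> = (\<integral>\<^sup>+y. ennreal (\<bar>y - 0\<bar> powr - \<delta>) \<partial>unit_leb) +
          (\<Sum>b\<in>I - {a}. (\<integral>\<^sup>+y. ennreal (\<bar>y - x b\<bar> powr - \<delta>) \<partial>unit_leb))"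
        by (subst nn_integral_add, rule m, intro borel_measurable_sum m, subst nn_integral_sum, rule m, rule refl)
      also have "\<dots> \<le> ?K + (\<Sum>b\<in>I - {a}. ?K)"
        using x assms by (intro add_mono sum_mono nn_integral_unit_powr_le) auto
      \<comment> \<open>One singularity at \<open>0\<close> and one at each of the \<open>p\<close>
        remaining coordinates.\<close>
      also have "\<dots> = of_nat (Suc p) * ?K"
      proof -
        have "card (I - {a}) = p" using Suc(2) a fin by simp
        then show ?thesis by (simp add: distrib_right)
      qed
      finally show "(\<integral>\<^sup>+y. ennreal (P a x) * ennreal (V a x y) \<partial>unit_leb) \<le> ennreal (P a x) * (of_nat (Suc p) * ?K)"
        by (subst nn_integral_cmult[OF m']) (rule mult_left_mono, simp_all)
    qed
    also have "\<dots> = (\<integral>\<^sup>+x. ennreal (P a x) \<partial>?U (I - {a})) * (of_nat (Suc p) * ?K)"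
      using mP[of a "I - {a}"] by (intro nn_integral_multc) auto
    also have "\<dots> < \<infinity>"
      using Suc(1)[of "I - {a}"] Suc(2) a fin
      by (simp add: P_def ennreal_mult_less_top of_nat_less_top)
    finally show ?thesis .
  qed
  have "(\<integral>\<^sup>+x. ennreal (\<Prod>a\<in>I. gap_weight \<delta> I x a) \<partial>?U I)
      \<le> (\<integral>\<^sup>+x. (\<Sum>a\<in>I. ennreal (P a x * V a x (x a))) \<partial>?U I)"
    using prod_gap_weight_le[OF fin ne]
    by (intro nn_integral_mono) (simp add: P_def V_def P0[unfolded P_def] V0[unfolded V_def] sum_nonneg)
  also have "\<dots> = (\<Sum>a\<in>I. (\<integral>\<^sup>+x. ennreal (P a x * V a x (x a)) \<partial>?U I))"
    using mP[of _ I] mV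
    by (intro nn_integral_sum measurable_compose[OF _ measurable_ennreal] borel_measurable_times) auto
  also have "\<dots> < \<infinity>" using step fin by simp
  finally show ?case .
qed

section \<open>The functions \<open>phi\<close> as products of gap powers\<close>

text \<open>The index \<open>n\<close> contributes the value \<open>0\<close>, which plays the role of \<open>t_0\<close>.\<close>
definition pred_pt :: "nat \<Rightarrow> (nat \<Rightarrow> real) \<Rightarrow> nat \<Rightarrow> real" where
  "pred_pt n t i = Max ((\<lambda>b. if b < n \<and> t b < t i then t b else 0) ` {..n})"

definition distinct_pt :: "nat \<Rightarrow> (nat \<Rightarrow> real) \<Rightarrow> bool" where
  "distinct_pt n t \<longleftrightarrow> (\<forall>i<n. t i \<in> {0<..<1}) \<and> inj_on t {..<n}"

lemma pred_pt_cases: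
  obtains "pred_pt n t i = 0" | b where "b < n" "t b < t i" "pred_pt n t i = t b"
proof -
  have "pred_pt n t i \<in> (\<lambda>b. if b < n \<and> t b < t i then t b else 0) ` {..n}"
    unfolding pred_pt_def by (rule Max_in) auto
  then show thesis using that by (auto split: if_splits)
qed

lemma pred_pt_nonneg: "0 \<le> pred_pt n t i"
  unfolding pred_pt_def by (rule Max_ge) (auto intro!: image_eqI[of _ _ n])

lemma pred_pt_ge: "b < n \<Longrightarrow> t b < t i \<Longrightarrow> t b \<le> pred_pt n t i"
  unfolding pred_pt_def by (rule Max_ge) (auto intro!: image_eqI[of _ _ b])

lemma pred_pt_less: "0 < t i \<Longrightarrow> pred_pt n t i < t i"
  by (rule pred_pt_cases[of n t i]) auto

text \<open>In the sorted list the entry before a value is its largest smaller coordinate, with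
  \<open>0\<close> at the start; the sorting permutation then reindexes the product.\<close>

lemma prod_sort_gaps:
  fixes t :: "nat \<Rightarrow> real" and g :: "real \<Rightarrow> real"
  assumes t: "distinct_pt n t"
  defines "s \<equiv> sort (map t [0..<n])"
  shows "(\<Prod>i<n. g (s ! i - (if i = 0 then 0 else s ! (i - 1)))) = (\<Prod>i<n. g (t i - pred_pt n t i))"
proof -
  have len: "length s = n" by (simp add: s_def)
  have "distinct s" using t by (simp add: s_def distinct_map distinct_pt_def atLeast0LessThan)
  then have sorted: "sorted_wrt (<) s"
    by (simp add: s_def strict_sorted_iff)
  have less: "s ! p < s ! q" if "p < q" "q < n" for p q
    using sorted_wrt_nth_less[OF sorted that(1)] that len by simp
  have "mset s = mset (map t [0..<n])" by (simp add: s_def)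
  then obtain \<sigma> where \<sigma>: "\<sigma> permutes {..<n}" "permute_list \<sigma> (map t [0..<n]) = s"
    by (rule mset_eq_permutation) auto
  have bij: "bij_betw \<sigma> {..<n} {..<n}" using \<sigma>(1) by (rule permutes_imp_bij)
  have s_nth: "s ! i = t (\<sigma> i)" if "i < n" for i
    using \<sigma> that bij_betwE[OF bij] by (auto simp: permute_list_nth)
  have gap: "(if i = 0 then 0 else s ! (i - 1)) = pred_pt n t (\<sigma> i)" if i: "i < n" for i
  proof (rule antisym)
    show "(if i = 0 then 0 else s ! (i - 1)) \<le> pred_pt n t (\<sigma> i)"
    proof (cases "i = 0")
      case False
      then have "i - 1 < n" "\<sigma> (i - 1) < n" "t (\<sigma> (i - 1)) < t (\<sigma> i)"
        using i bij_betwE[OF bij] less[of "i - 1" i] s_nth[of i] s_nth[of "i - 1"] by auto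
      then show ?thesis using pred_pt_ge[of "\<sigma> (i - 1)" n t "\<sigma> i"] s_nth[of "i - 1"] False by simp
    qed (simp add: pred_pt_nonneg)
  next
    show "pred_pt n t (\<sigma> i) \<le> (if i = 0 then 0 else s ! (i - 1))"
    proof (rule pred_pt_cases[of n t "\<sigma> i"])
      assume "pred_pt n t (\<sigma> i) = 0"
      moreover have "0 \<le> s ! (i - 1)"
        using t i s_nth[of "i - 1"] bij_betwE[OF bij, rule_format, of "i - 1"] by (auto simp: distinct_pt_def less_imp_le)
      ultimately show ?thesis by simp
    next
      fix b assume b: "b < n" "t b < t (\<sigma> i)" "pred_pt n t (\<sigma> i) = t b"
      then obtain q where q: "q < n" "b = \<sigma> q" using bij by (auto simp: bij_betw_def)
      \<comment> \<open>A predecessor that is itself a coordinate stands earlier in the sorted list,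
        hence is at most the entry just before position \<open>i\<close>.\<close>
      have "q < i" using less[of i q] b q i s_nth[of q] s_nth[of i]
        by (cases q i rule: linorder_cases) auto
      then have "s ! q \<le> s ! (i - 1)" using less[of q "i - 1"] i by (cases "q = i - 1") (auto simp: less_imp_le)
      then show ?thesis using b q s_nth[of q] \<open>q < i\<close> by simp
    qed
  qed
  have "(\<Prod>i<n. g (s ! i - (if i = 0 then 0 else s ! (i - 1)))) = (\<Prod>i<n. g (t (\<sigma> i) - pred_pt n t (\<sigma> i)))"
    using gap s_nth by (intro prod.cong) auto
  also have "\<dots> = (\<Prod>i<n. g (t i - pred_pt n t i))"
    by (rule prod.reindex_bij_betw[OF bij])
  finally show ?thesis .
qed

text \<open>This is \<open>phi\<close> up to a constant. Predecessors replace the sorted list, so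
  each factor stays attached to its own coordinate.\<close>

definition gap_prod :: "real \<Rightarrow> nat \<Rightarrow> (nat \<Rightarrow> real) \<Rightarrow> real" where
  "gap_prod \<beta> n t = (if distinct_pt n t then \<Prod>i<n. (t i - pred_pt n t i) powr - \<beta> else 0)"

text \<open>
  Outside the case \<open>1 - H < \<alpha> < 1\<close> the function is a constant on distinct points, which is the case
  \<open>\<beta> = 0\<close>. The value of the constant is irrelevant, so that even the junk value \<open>undefined\<close> in the
  definition of \<open>phi\<close> does no harm.
\<close>
lemma phi_eq_gap_prod:
  fixes M :: "'w measure"
  assumes "1 / 2 < H" "H < 1" "2 < \<alpha> + 2 * H"
  obtains \<beta> and c :: "nat \<Rightarrow> real"
  where "0 \<le> \<beta>" "\<beta> + (2 - 2 * H) < 1" "\<And>n t. phi H \<alpha> M \<tau> n t = c n * gap_prod \<beta> n t"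
proof (cases "\<alpha> < 1")
  case True
  have "phi H \<alpha> M \<tau> n t = ((\<alpha> * sin (pi * \<alpha>) / pi) ^ n) * gap_prod (1 - \<alpha>) n t" for n t
  proof (cases "n = 0 \<or> \<not> distinct_pt n t")
    case True
    then show ?thesis by (auto simp: phi_def gap_prod_def distinct_pt_def)
  next
    case False
    then have "\<not> (\<not> (\<forall>i<n. t i \<in> {0<..<1}) \<or> \<not> inj_on t {..<n})" by (simp add: distinct_pt_def)
    \<comment> \<open>Indeed \<open>\<alpha> > 2 * (1 - H) > 1 - H\<close>.\<close>
    moreover have "1 - H < \<alpha> \<and> \<alpha> < 1" using assms True by auto
    ultimately show ?thesis
      using False prod_sort_gaps[of n t "\<lambda>x. x powr (\<alpha> - 1)"]
      unfolding phi_def Let_def by (simp only: if_False if_True) (simp add: gap_prod_def)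
  qed
  \<comment> \<open>For \<open>\<beta> = 1 - \<alpha>\<close> the condition
    \<open>\<beta> + (2 - 2 * H) < 1\<close> is exactly \<open>2 < \<alpha> + 2 * H\<close>.\<close>
  then show ?thesis using True assms by (intro that[of "1 - \<alpha>"]) auto
next
  case False
  define c :: "nat \<Rightarrow> real" where "c n =
    (if n = 0 then 1 else if integrable M (\<lambda>\<omega>. real (\<tau> \<omega>)) then (1 / (\<integral>\<omega>. real (\<tau> \<omega>) \<partial>M)) ^ n
     else if \<alpha> = 1 then 1 else undefined)" for n
  have "phi H \<alpha> M \<tau> n t = c n * gap_prod 0 n t" for n t
  proof -
    \<comment> \<open>Positivity of the gap matters here, as \<open>0 powr 0 = 0\<close>.\<close>
    have "(t i - pred_pt n t i) powr - 0 = 1" if "distinct_pt n t" "i < n" for i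
      using that pred_pt_less[of t i n] by (auto simp: distinct_pt_def)
    then have "gap_prod 0 n t = (if distinct_pt n t then 1 else 0)"
      by (auto simp: gap_prod_def)
    then show ?thesis using False by (auto simp: phi_def c_def distinct_pt_def)
  qed
  then show ?thesis using assms False by (intro that[of 0 c]) auto
qed

lemma borel_measurable_gap_prod: "gap_prod \<beta> n \<in> borel_measurable (cube n)"
proof -
  note coord = measurable_coord_cube
  have less: "Measurable.pred (cube n) (\<lambda>t. t b < t i)" if "b < n" "i < n" for b i
    using coord[OF that(1)] coord[OF that(2)] by measurable
  have "Measurable.pred (cube n) (\<lambda>t. \<forall>i\<in>{..<n}. 0 < t i \<and> t i < 1 \<and> (\<forall>j\<in>{..<n}. t i = t j \<longrightarrow> i = j))"
  proof (intro pred_intros_finite pred_intros_logic)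
    fix i j assume i: "i \<in> {..<n}" and j: "j \<in> {..<n}"
    have [measurable]: "(\<lambda>t. t i) \<in> borel_measurable (cube n)" "(\<lambda>t. t j) \<in> borel_measurable (cube n)"
      using i j coord by auto
    show "Measurable.pred (cube n) (\<lambda>t. 0 < t i)" "Measurable.pred (cube n) (\<lambda>t. t i < 1)"
      by measurable
    show "Measurable.pred (cube n) (\<lambda>t. t i = t j)"
      unfolding pred_def by (rule borel_measurable_eq) measurable
  qed auto
  also have "(\<lambda>t. \<forall>i\<in>{..<n}. 0 < t i \<and> t i < 1 \<and> (\<forall>j\<in>{..<n}. t i = t j \<longrightarrow> i = j)) = distinct_pt n"
    by (auto simp: distinct_pt_def inj_on_def fun_eq_iff)
  finally have D: "Measurable.pred (cube n) (\<lambda>t. distinct_pt n t)" .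
  have "(\<lambda>t. pred_pt n t i) \<in> borel_measurable (cube n)" if i: "i < n" for i
    unfolding pred_pt_def
  proof (rule borel_measurable_Max)
    fix b
    show "(\<lambda>t. if b < n \<and> t b < t i then t b else 0) \<in> borel_measurable (cube n)"
      using less[OF _ i, of b] coord[of b n] by (cases "b < n") (auto intro!: measurable_If)
  qed simp
  then have "(\<lambda>t. \<Prod>i<n. (t i - pred_pt n t i) powr - \<beta>) \<in> borel_measurable (cube n)"
    by (intro borel_measurable_prod powr_real_measurable borel_measurable_diff coord) auto
  then show ?thesis unfolding gap_prod_def using D by (intro measurable_If) auto
qed

lemma gap_prod_nonneg: "0 \<le> gap_prod \<beta> n t"
  by (auto simp: gap_prod_def intro: prod_nonneg)

section \<open>Charging the kernels to the larger point\<close>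

text \<open>The share of the kernel of the pair \<open>a\<close>, \<open>b\<close> that is charged
  to \<open>a\<close>; the neutral value \<open>1\<close> leaves it to the larger point.\<close>

definition up_kernel :: "real \<Rightarrow> (nat \<Rightarrow> real) \<Rightarrow> nat \<Rightarrow> nat \<Rightarrow> real" where
  "up_kernel \<gamma> x a b = (if x b < x a then (x a - x b) powr - \<gamma> else 1)"

lemma up_kernel_nonneg: "0 \<le> up_kernel \<gamma> x a b"
  by (simp add: up_kernel_def)

text \<open>Equality holds if \<open>x a\<close> and \<open>x b\<close> differ. If they coincide,
  the left side is \<open>0 powr - \<gamma> = 0\<close> and the right side is
  \<open>1\<close>.\<close>

lemma kernel_le_up_kernel: "\<bar>x a - x b\<bar> powr - \<gamma> \<le> up_kernel \<gamma> x a b * up_kernel \<gamma> x b a"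
  by (auto simp: up_kernel_def abs_if)

text \<open>Both bases may be replaced by the smaller one, since the exponents are nonpositive. This
  merges a gap and a kernel into a single power.\<close>

lemma powr_mult_powr_le:
  fixes u v \<beta> \<gamma> :: real
  assumes "0 < u" "0 < v" "0 \<le> \<beta>" "0 \<le> \<gamma>"
  shows "u powr - \<beta> * v powr - \<gamma> \<le> max (u powr - (\<beta> + \<gamma>)) (v powr - (\<beta> + \<gamma>))"
proof -
  have "u powr - \<beta> * v powr - \<gamma> \<le> min u v powr - \<beta> * min u v powr - \<gamma>"
    using assms by (intro mult_mono powr_mono2') auto
  also have "\<dots> = min u v powr - (\<beta> + \<gamma>)" by (simp add: powr_add[symmetric])
  also have "\<dots> \<le> max (u powr - (\<beta> + \<gamma>)) (v powr - (\<beta> + \<gamma>))" by (auto simp: min_def max_def)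
  finally show ?thesis .
qed

lemma gap_le_gap_weight:
  assumes "finite I" "c \<in> I" "x c < x a"
  shows "(x a - x c) powr - \<delta> \<le> gap_weight \<delta> I x a"
proof -
  have "(if x c < x a then (x a - x c) powr - \<delta> else 0)
      \<le> (\<Sum>b\<in>I. if x b < x a then (x a - x b) powr - \<delta> else 0)"
    using assms by (intro member_le_sum) auto
  moreover have "0 \<le> x a powr - \<delta>" by simp
  ultimately show ?thesis unfolding gap_weight_def using assms(3) by (simp only: if_True)
qed

text \<open>Here \<open>p\<close> is the predecessor of \<open>x a\<close> in its chain and
  \<open>b\<close> the partner of \<open>a\<close> in the matching. The merged power has as base a
  distance to a smaller value, so it is bounded by a term of the weight.\<close>

lemma gap_mult_up_kernel_le:
  assumes I: "finite I" "b \<in> I" and p: "p = 0 \<or> (\<exists>c\<in>I. p = x c)" "0 \<le> p" "p < x a" "x a \<le> 1"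
    and "0 \<le> \<beta>" "0 \<le> \<gamma>"
  shows "(x a - p) powr - \<beta> * up_kernel \<gamma> x a b \<le> gap_weight (\<beta> + \<gamma>) I x a"
proof -
  have gap: "(x a - p) powr - (\<beta> + \<gamma>) \<le> gap_weight (\<beta> + \<gamma>) I x a"
  proof (cases "p = 0")
    case True
    then show ?thesis unfolding gap_weight_def by (auto intro: sum_nonneg)
  next
    case False
    then obtain c where "c \<in> I" "p = x c" using p(1) by auto
    then show ?thesis using p(3) I(1) by (auto intro: gap_le_gap_weight simp del: minus_add_distrib)
  qed
  show ?thesis
  proof (cases "x b < x a")
    case True
    then have "(x a - p) powr - \<beta> * up_kernel \<gamma> x a b
        \<le> max ((x a - p) powr - (\<beta> + \<gamma>)) ((x a - x b) powr - (\<beta> + \<gamma>))"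
      unfolding up_kernel_def using p assms(7,8) by (simp add: powr_mult_powr_le del: minus_add_distrib)
    also have "\<dots> \<le> gap_weight (\<beta> + \<gamma>) I x a"
      using gap gap_le_gap_weight[OF I True] by (simp del: minus_add_distrib)
    finally show ?thesis .
  next
    case False
    then have "(x a - p) powr - \<beta> * up_kernel \<gamma> x a b = (x a - p) powr - \<beta>" by (simp add: up_kernel_def)
    \<comment> \<open>The gap lies in \<open>(0, 1]\<close>, so lowering the exponent only increases
      the power.\<close>
    also have "\<dots> \<le> (x a - p) powr - (\<beta> + \<gamma>)"
      using powr_mult_powr_le[of "x a - p" 1 \<beta> \<gamma>] powr_mono'[of "- (\<beta> + \<gamma>)" "- \<beta>" "x a - p"] p assms(7,8) by auto
    finally show ?thesis using gap by linarith
  qed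
qed

text \<open>The tuple \<open>y\<close> is one chain inside the larger tuple \<open>x\<close>;
  \<open>\<iota>\<close> locates its points and \<open>q\<close> their partners. Predecessors are
  taken within the chain, which \<open>I\<close> contains, so the estimate holds factor by
  factor.\<close>

lemma gap_prod_mult_up_kernel_le:
  assumes I: "finite I" "\<And>i. i < n \<Longrightarrow> \<iota> i \<in> I" "\<And>i. i < n \<Longrightarrow> q i \<in> I"
    and y: "\<And>i. i < n \<Longrightarrow> y i = x (\<iota> i)" and "0 \<le> \<beta>" "0 \<le> \<gamma>"
  shows "gap_prod \<beta> n y * (\<Prod>i<n. up_kernel \<gamma> x (\<iota> i) (q i)) \<le> (\<Prod>i<n. gap_weight (\<beta> + \<gamma>) I x (\<iota> i))"
proof (cases "distinct_pt n y")
  case True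
  have "(y i - pred_pt n y i) powr - \<beta> * up_kernel \<gamma> x (\<iota> i) (q i) \<le> gap_weight (\<beta> + \<gamma>) I x (\<iota> i)"
    if i: "i < n" for i
  proof -
    have yi: "0 < y i" "y i < 1" using True i by (auto simp: distinct_pt_def)
    have "pred_pt n y i = 0 \<or> (\<exists>c\<in>I. pred_pt n y i = x c)"
      by (rule pred_pt_cases[of n y i]) (use I y in auto)
    then show ?thesis using yi y[OF i] pred_pt_less[of y i n] pred_pt_nonneg[of n y i] I i assms(5,6)
      by (auto intro!: gap_mult_up_kernel_le)
  qed
  then have "(\<Prod>i<n. (y i - pred_pt n y i) powr - \<beta> * up_kernel \<gamma> x (\<iota> i) (q i)) \<le> (\<Prod>i<n. gap_weight (\<beta> + \<gamma>) I x (\<iota> i))"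
    by (intro prod_mono) (auto simp: up_kernel_nonneg)
  then show ?thesis using True by (simp add: gap_prod_def prod.distrib)
next
  case False
  then show ?thesis by (simp add: gap_prod_def prod_nonneg gap_weight_nonneg)
qed

section \<open>Domination of the trace integrand by gap weights\<close>

lemma prod_lessThan_add:
  fixes g :: "nat \<Rightarrow> 'a::comm_monoid_mult"
  shows "(\<Prod>i<p + q. g i) = (\<Prod>i<p. g i) * (\<Prod>i<q. g (p + i))"
  by (induction q) (simp_all add: mult.assoc)

lemma prod_lessThan_double:
  fixes g :: "nat \<Rightarrow> 'a::comm_monoid_mult"
  shows "(\<Prod>i<2 * j. g i) = (\<Prod>i<j. g (2 * i + 1) * g (2 * i))"
  by (induction j) (simp_all add: ac_simps)

text \<open>The second index of \<open>up_kernel\<close> is the other member of the trace pair, and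
  \<open>p\<close> is the offset of the block of trace variables in \<open>x\<close>.\<close>

lemma prod_kernel_pairs_le:
  "(\<Prod>i<j. \<bar>x (p + (2 * i + 1)) - x (p + 2 * i)\<bar> powr - \<gamma>)
    \<le> (\<Prod>i<2 * j. up_kernel \<gamma> x (p + i) (p + (if even i then i + 1 else i - 1)))"
proof -
  have "(\<Prod>i<j. \<bar>x (p + (2 * i + 1)) - x (p + 2 * i)\<bar> powr - \<gamma>)
    \<le> (\<Prod>i<j. up_kernel \<gamma> x (p + (2 * i + 1)) (p + 2 * i) * up_kernel \<gamma> x (p + 2 * i) (p + (2 * i + 1)))"
    by (intro prod_mono) (auto intro: kernel_le_up_kernel)
  then show ?thesis unfolding prod_lessThan_double by simp
qed

text \<open>
  The coordinates of \<open>x\<close> are listed in the order \<open>z, z', s, s'\<close>, which is the order of integration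
  in the norm of a trace.
\<close>
lemma trace_integrand_le_gap_weights:
  fixes j r :: nat and z z' s s' :: "nat \<Rightarrow> real"
  defines "x \<equiv> concat_pt (r + r) (concat_pt r z z') (concat_pt (2 * j) s s')"
    and "I \<equiv> {..<(r + r) + (2 * j + 2 * j)}"
  assumes "0 \<le> \<beta>" "0 \<le> \<gamma>"
  shows "gap_prod \<beta> (2 * j + r) (concat_pt (2 * j) s z) * (\<Prod>i<j. \<bar>s (2 * i + 1) - s (2 * i)\<bar> powr - \<gamma>) *
      (gap_prod \<beta> (2 * j + r) (concat_pt (2 * j) s' z') * (\<Prod>i<j. \<bar>s' (2 * i + 1) - s' (2 * i)\<bar> powr - \<gamma>)) *
      (\<Prod>i<r. \<bar>z i - z' i\<bar> powr - \<gamma>)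
    \<le> (\<Prod>a\<in>I. gap_weight (\<beta> + \<gamma>) I x a)"
proof -
  let ?n = "2 * j + r"
  let ?y = "concat_pt (2 * j) s z" and ?y' = "concat_pt (2 * j) s' z'"
  let ?k = "\<Prod>i<j. \<bar>s (2 * i + 1) - s (2 * i)\<bar> powr - \<gamma>" and ?k' = "\<Prod>i<j. \<bar>s' (2 * i + 1) - s' (2 * i)\<bar> powr - \<gamma>"
  let ?l = "\<Prod>i<r. \<bar>z i - z' i\<bar> powr - \<gamma>"
  define flip :: "nat \<Rightarrow> nat" where "flip i = (if even i then i + 1 else i - 1)" for i
  have flip: "flip i < 2 * j" "flip i < 4 * j" if "i < 2 * j" for i
    using that unfolding flip_def by auto
  \<comment> \<open>\<open>\<iota>\<close> and \<open>\<iota>'\<close> locate the chains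
    \<open>(s, z)\<close> and \<open>(s', z')\<close> inside \<open>x\<close>. \<open>q\<close> and
    \<open>q'\<close> encode the matching: a trace variable goes to the other member of its pair,
    and \<open>z i\<close> and \<open>z' i\<close> go to each other.\<close>
  define \<iota> q \<iota>' q' :: "nat \<Rightarrow> nat" where
    "\<iota> i = (if i < 2 * j then (r + r) + i else i - 2 * j)" and
    "q i = (if i < 2 * j then (r + r) + flip i else r + (i - 2 * j))" and
    "\<iota>' i = (if i < 2 * j then (r + r + 2 * j) + i else r + (i - 2 * j))" and
    "q' i = (if i < 2 * j then (r + r + 2 * j) + flip i else i - 2 * j)" for i
  let ?U = "\<Prod>i<?n. up_kernel \<gamma> x (\<iota> i) (q i)" and ?U' = "\<Prod>i<?n. up_kernel \<gamma> x (\<iota>' i) (q' i)"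
  have x_z: "x i = z i" "x (r + i) = z' i" if "i < r" for i
    using that by (simp_all add: x_def concat_pt_def)
  have x_z': "x (r + i - 2 * j) = z' (i - 2 * j)" if "\<not> i < 2 * j" "i < 2 * j + r" for i
    using that x_z(2)[of "i - 2 * j"] by simp
  have x_s: "x ((r + r) + i) = s i" "x ((r + r + 2 * j) + i) = s' i" if "i < 2 * j" for i
    using that by (simp_all add: x_def concat_pt_def)
  have c: "gap_prod \<beta> ?n ?y * ?U \<le> (\<Prod>i<?n. gap_weight (\<beta> + \<gamma>) I x (\<iota> i))"
    using assms(3,4) x_z x_s flip by (intro gap_prod_mult_up_kernel_le) (auto simp: I_def concat_pt_def \<iota>_def q_def less_diff_conv2)
  have c': "gap_prod \<beta> ?n ?y' * ?U' \<le> (\<Prod>i<?n. gap_weight (\<beta> + \<gamma>) I x (\<iota>' i))"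
    using assms(3,4) x_z' x_s flip by (intro gap_prod_mult_up_kernel_le) (auto simp: I_def concat_pt_def \<iota>'_def q'_def less_diff_conv2)
  have "?k = (\<Prod>i<j. \<bar>x ((r + r) + (2 * i + 1)) - x ((r + r) + 2 * i)\<bar> powr - \<gamma>)"
    by (intro prod.cong refl, subst (1 2) x_s(1)) auto
  also have "\<dots> \<le> (\<Prod>i<2 * j. up_kernel \<gamma> x ((r + r) + i) ((r + r) + flip i))"
    unfolding flip_def by (rule prod_kernel_pairs_le)
  also have "\<dots> = (\<Prod>i<2 * j. up_kernel \<gamma> x (\<iota> i) (q i))"
    by (simp add: \<iota>_def q_def)
  finally have k: "?k \<le> (\<Prod>i<2 * j. up_kernel \<gamma> x (\<iota> i) (q i))" .
  have "?k' = (\<Prod>i<j. \<bar>x ((r + r + 2 * j) + (2 * i + 1)) - x ((r + r + 2 * j) + 2 * i)\<bar> powr - \<gamma>)"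
    by (intro prod.cong refl, subst (1 2) x_s(2)) auto
  also have "\<dots> \<le> (\<Prod>i<2 * j. up_kernel \<gamma> x ((r + r + 2 * j) + i) ((r + r + 2 * j) + flip i))"
    unfolding flip_def by (rule prod_kernel_pairs_le)
  also have "\<dots> = (\<Prod>i<2 * j. up_kernel \<gamma> x (\<iota>' i) (q' i))"
    by (simp add: \<iota>'_def q'_def)
  finally have k': "?k' \<le> (\<Prod>i<2 * j. up_kernel \<gamma> x (\<iota>' i) (q' i))" .
  have "?l \<le> (\<Prod>i<r. up_kernel \<gamma> x i (r + i) * up_kernel \<gamma> x (r + i) i)"
    using kernel_le_up_kernel[where x = x and \<gamma> = \<gamma>] x_z
    by (intro prod_mono) (auto simp: x_z[symmetric])
  \<comment> \<open>The kernels of the norm join the two chains, so each is shared between the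
    factors of both.\<close>
  then have l: "?l \<le> (\<Prod>i<r. up_kernel \<gamma> x (\<iota> (2 * j + i)) (q (2 * j + i))) * (\<Prod>i<r. up_kernel \<gamma> x (\<iota>' (2 * j + i)) (q' (2 * j + i)))"
    by (simp add: \<iota>_def q_def \<iota>'_def q'_def prod.distrib)
  have "?k * ?k' * ?l \<le> (\<Prod>i<2 * j. up_kernel \<gamma> x (\<iota> i) (q i)) * (\<Prod>i<2 * j. up_kernel \<gamma> x (\<iota>' i) (q' i)) *
     ((\<Prod>i<r. up_kernel \<gamma> x (\<iota> (2 * j + i)) (q (2 * j + i))) * (\<Prod>i<r. up_kernel \<gamma> x (\<iota>' (2 * j + i)) (q' (2 * j + i))))"
    by (intro mult_mono k k' l mult_nonneg_nonneg prod_nonneg ballI up_kernel_nonneg) auto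
  also have "\<dots> = ?U * ?U'" by (simp only: prod_lessThan_add) (simp only: mult_ac)
  finally have ker: "?k * ?k' * ?l \<le> ?U * ?U'" .
  have "gap_prod \<beta> ?n ?y * ?k * (gap_prod \<beta> ?n ?y' * ?k') * ?l
      = (gap_prod \<beta> ?n ?y * gap_prod \<beta> ?n ?y') * (?k * ?k' * ?l)" by (simp only: ac_simps)
  also have "\<dots> \<le> (gap_prod \<beta> ?n ?y * gap_prod \<beta> ?n ?y') * (?U * ?U')"
    by (intro mult_left_mono ker mult_nonneg_nonneg gap_prod_nonneg)
  also have "\<dots> = (gap_prod \<beta> ?n ?y * ?U) * (gap_prod \<beta> ?n ?y' * ?U')" by (simp only: ac_simps)
  also have "\<dots> \<le> (\<Prod>i<?n. gap_weight (\<beta> + \<gamma>) I x (\<iota> i)) * (\<Prod>i<?n. gap_weight (\<beta> + \<gamma>) I x (\<iota>' i))"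
    by (intro mult_mono c c' mult_nonneg_nonneg prod_nonneg ballI gap_weight_nonneg gap_prod_nonneg up_kernel_nonneg)
  \<comment> \<open>The values of \<open>\<iota>\<close> and \<open>\<iota>'\<close> together run
    through \<open>I\<close> exactly once.\<close>
  also have "\<dots> = (\<Prod>a\<in>I. gap_weight (\<beta> + \<gamma>) I x a)"
    unfolding I_def by (simp only: prod_lessThan_add) (simp add: \<iota>_def \<iota>'_def mult_ac add.assoc)
  finally show ?thesis .
qed

section \<open>Energies\<close>

definition riesz_prod :: "real \<Rightarrow> nat \<Rightarrow> (nat \<Rightarrow> real) \<Rightarrow> (nat \<Rightarrow> real) \<Rightarrow> real" where
  "riesz_prod H n s t = (\<Prod>i<n. \<bar>s i - t i\<bar> powr (2 * H - 2))"

definition trace_kernel :: "real \<Rightarrow> nat \<Rightarrow> (nat \<Rightarrow> real) \<Rightarrow> real" where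
  "trace_kernel H j s = (\<Prod>i<j. \<bar>s (2 * i + 1) - s (2 * i)\<bar> powr (2 * H - 2))"

text \<open>The squared norm as an iterated integral with values in \<open>[0, \<infinity>]\<close>,
  so that it applies to inner integrals whose finiteness is not yet known.\<close>

definition energy :: "real \<Rightarrow> nat \<Rightarrow> ((nat \<Rightarrow> real) \<Rightarrow> ennreal) \<Rightarrow> ennreal" where
  "energy H n G = (\<integral>\<^sup>+s. \<integral>\<^sup>+t. G s * G t * ennreal (riesz_prod H n s t) \<partial>cube n \<partial>cube n)"

lemma riesz_prod_nonneg: "0 \<le> riesz_prod H n s t"
  unfolding riesz_prod_def by (intro prod_nonneg) auto

lemma trace_kernel_nonneg: "0 \<le> trace_kernel H j s"
  unfolding trace_kernel_def by (intro prod_nonneg) auto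

lemma measurable_riesz_prod [measurable (raw)]:
  assumes f: "f \<in> measurable N (cube n)" and g: "g \<in> measurable N (cube n)"
  shows "(\<lambda>x. riesz_prod H n (f x) (g x)) \<in> borel_measurable N"
  unfolding riesz_prod_def
proof (intro borel_measurable_prod powr_real_measurable borel_measurable_abs borel_measurable_diff borel_measurable_const)
  fix i assume "i \<in> {..<n}"
  then show "(\<lambda>x. f x i) \<in> borel_measurable N" "(\<lambda>x. g x i) \<in> borel_measurable N"
    using measurable_compose[OF f measurable_coord_cube, of i] measurable_compose[OF g measurable_coord_cube, of i] by auto
qed

lemma measurable_trace_kernel [measurable (raw)]:
  assumes f: "f \<in> measurable N (cube (2 * j))"
  shows "(\<lambda>x. trace_kernel H j (f x)) \<in> borel_measurable N"
  unfolding trace_kernel_def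
proof (intro borel_measurable_prod powr_real_measurable borel_measurable_abs borel_measurable_diff borel_measurable_const)
  fix i assume "i \<in> {..<j}"
  then show "(\<lambda>x. f x (2 * i + 1)) \<in> borel_measurable N" "(\<lambda>x. f x (2 * i)) \<in> borel_measurable N"
    using measurable_compose[OF f measurable_coord_cube, of "2 * i"] measurable_compose[OF f measurable_coord_cube, of "2 * i + 1"] by auto
qed

lemma absH_norm_sq_eq_energy:
  assumes [measurable]: "f \<in> borel_measurable (cube n)"
  shows "absH_norm_sq H n f = energy H n (\<lambda>t. ennreal \<bar>f t\<bar>)"
proof -
  have "absH_norm_sq H n f = (\<integral>\<^sup>+z. (case z of (s, t) \<Rightarrow> ennreal (\<bar>f s * f t\<bar> * riesz_prod H n s t)) \<partial>(cube n \<Otimes>\<^sub>M cube n))"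
    by (simp add: absH_norm_sq_def riesz_prod_def)
  also have "\<dots> = (\<integral>\<^sup>+s. \<integral>\<^sup>+t. ennreal (\<bar>f s * f t\<bar> * riesz_prod H n s t) \<partial>cube n \<partial>cube n)"
    by (subst cube.nn_integral_fst[symmetric]) simp_all
  also have "\<dots> = energy H n (\<lambda>t. ennreal \<bar>f t\<bar>)"
    by (simp add: energy_def abs_mult ennreal_mult riesz_prod_nonneg)
  finally show ?thesis .
qed

lemma energy_mono_AE:
  assumes "AE t in cube n. G t \<le> G' t"
  shows "energy H n G \<le> energy H n G'"
  unfolding energy_def
proof (rule nn_integral_mono_AE)
  show "AE s in cube n. (\<integral>\<^sup>+t. G s * G t * ennreal (riesz_prod H n s t) \<partial>cube n)
      \<le> (\<integral>\<^sup>+t. G' s * G' t * ennreal (riesz_prod H n s t) \<partial>cube n)"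
    using assms
  proof eventually_elim
    case (elim s)
    note s = elim
    show ?case
    proof (rule nn_integral_mono_AE)
      show "AE t in cube n. G s * G t * ennreal (riesz_prod H n s t) \<le> G' s * G' t * ennreal (riesz_prod H n s t)"
        using assms by eventually_elim (use s in \<open>auto intro!: mult_mono\<close>)
    qed
  qed
qed

text \<open>Off the diagonals all distances lie in \<open>(0, 1]\<close> and the exponent is
  negative. On a diagonal the kernel is \<open>0\<close> by convention, hence the restriction to
  almost every \<open>v\<close>.\<close>

lemma AE_riesz_prod_ge_1:
  assumes "H < 1" "u \<in> space (cube k)"
  shows "AE v in cube k. 1 \<le> riesz_prod H k u v"
proof -
  have "AE v in cube k. \<forall>i\<in>{..<k}. v i \<noteq> u i"
    unfolding cube_eq
    by (intro AE_finite_allI AE_PiM_component prob_space_unit_leb AE_unit_leb_neq) auto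
  moreover have "AE v in cube k. v \<in> space (cube k)" by (rule AE_space)
  ultimately show ?thesis
  proof eventually_elim
    case (elim v)
    have "1 \<le> \<bar>u i - v i\<bar> powr (2 * H - 2)" if "i < k" for i
    proof -
      have "u i \<in> {0..1}" "v i \<in> {0..1}" using assms(2) elim(2) that by (auto simp: space_cube PiE_iff)
      then have "0 < \<bar>u i - v i\<bar>" "\<bar>u i - v i\<bar> \<le> 1" using bspec[OF elim(1), of i] that by auto
      then show ?thesis
        using powr_mono'[of "2 * H - 2" 0 "\<bar>u i - v i\<bar>"] assms(1) by simp
    qed
    then show ?case unfolding riesz_prod_def by (intro prod_ge_1) auto
  qed
qed

lemma riesz_prod_concat_pt:
  "riesz_prod H (r + k) (concat_pt r t u) (concat_pt r t' u') = riesz_prod H r t t' * riesz_prod H k u u'"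
  unfolding riesz_prod_def prod_lessThan_add by (simp add: concat_pt_def)

text \<open>The point is that the kernel is at least \<open>1\<close> on the cube.\<close>
lemma energy_nn_integral_le:
  assumes H: "H < 1" and [measurable]: "G \<in> borel_measurable (cube (r + k))"
  shows "energy H r (\<lambda>t. \<integral>\<^sup>+u. G (concat_pt r t u) \<partial>cube k) \<le> energy H (r + k) G"
proof -
  let ?G = "\<lambda>t u. G (concat_pt r t u)"
  let ?E = "\<lambda>t u t' u'. ?G t u * ?G t' u' * ennreal (riesz_prod H (r + k) (concat_pt r t u) (concat_pt r t' u'))"
  have "energy H r (\<lambda>t. \<integral>\<^sup>+u. ?G t u \<partial>cube k)
      \<le> (\<integral>\<^sup>+t. \<integral>\<^sup>+t'. \<integral>\<^sup>+u. \<integral>\<^sup>+u'. ?E t u t' u' \<partial>cube k \<partial>cube k \<partial>cube r \<partial>cube r)"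
    unfolding energy_def
  proof (intro nn_integral_mono)
    fix t t' assume [measurable]: "t \<in> space (cube r)" "t' \<in> space (cube r)"
    have "(\<integral>\<^sup>+u. ?G t u \<partial>cube k) * (\<integral>\<^sup>+u'. ?G t' u' \<partial>cube k) * ennreal (riesz_prod H r t t')
      = (\<integral>\<^sup>+u. ?G t u * ((\<integral>\<^sup>+u'. ?G t' u' \<partial>cube k) * ennreal (riesz_prod H r t t')) \<partial>cube k)"
      by (simp add: nn_integral_multc mult.assoc)
    also have "\<dots> = (\<integral>\<^sup>+u. \<integral>\<^sup>+u'. ?G t u * (?G t' u' * ennreal (riesz_prod H r t t')) \<partial>cube k \<partial>cube k)"
      by (simp add: nn_integral_multc nn_integral_cmult)
    also have "\<dots> \<le> (\<integral>\<^sup>+u. \<integral>\<^sup>+u'. ?E t u t' u' \<partial>cube k \<partial>cube k)"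
    proof (rule nn_integral_mono, rule nn_integral_mono_AE)
      fix u assume "u \<in> space (cube k)"
      from AE_riesz_prod_ge_1[OF H this]
      show "AE u' in cube k. ?G t u * (?G t' u' * ennreal (riesz_prod H r t t')) \<le> ?E t u t' u'"
      proof eventually_elim
        case (elim u')
        \<comment> \<open>Inserting the missing kernel factors of \<open>u\<close> and
          \<open>u'\<close> can only increase the integrand.\<close>
        have "riesz_prod H r t t' \<le> riesz_prod H r t t' * riesz_prod H k u u'"
          using elim riesz_prod_nonneg[of H r t t'] by (simp add: mult_le_cancel_left1)
        then show ?case
          by (simp add: riesz_prod_concat_pt mult.assoc mult_left_mono ennreal_leI)
      qed
    qed
    finally show "(\<integral>\<^sup>+u. ?G t u \<partial>cube k) * (\<integral>\<^sup>+u'. ?G t' u' \<partial>cube k) * ennreal (riesz_prod H r t t')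
      \<le> (\<integral>\<^sup>+u. \<integral>\<^sup>+u'. ?E t u t' u' \<partial>cube k \<partial>cube k)" .
  qed
  \<comment> \<open>Exchanging \<open>t'\<close> and \<open>u\<close> brings \<open>t'\<close> next
    to \<open>u'\<close>, so that \<open>(t, u)\<close> and \<open>(t', u')\<close> each merge into
    one point of the larger cube.\<close>
  also have "\<dots> = (\<integral>\<^sup>+t. \<integral>\<^sup>+u. \<integral>\<^sup>+t'. \<integral>\<^sup>+u'. ?E t u t' u' \<partial>cube k \<partial>cube r \<partial>cube k \<partial>cube r)"
  proof (intro nn_integral_cong)
    fix t assume [measurable]: "t \<in> space (cube r)"
    show "(\<integral>\<^sup>+t'. \<integral>\<^sup>+u. \<integral>\<^sup>+u'. ?E t u t' u' \<partial>cube k \<partial>cube k \<partial>cube r)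
      = (\<integral>\<^sup>+u. \<integral>\<^sup>+t'. \<integral>\<^sup>+u'. ?E t u t' u' \<partial>cube k \<partial>cube r \<partial>cube k)"
      by (rule cube_pair.Fubini'[symmetric]) measurable
  qed
  also have "\<dots> = (\<integral>\<^sup>+t. \<integral>\<^sup>+u. \<integral>\<^sup>+x'. ?G t u * G x' * ennreal (riesz_prod H (r + k) (concat_pt r t u) x') \<partial>cube (r + k) \<partial>cube k \<partial>cube r)"
  proof (intro nn_integral_cong)
    fix t u assume [measurable]: "t \<in> space (cube r)" "u \<in> space (cube k)"
    show "(\<integral>\<^sup>+t'. \<integral>\<^sup>+u'. ?E t u t' u' \<partial>cube k \<partial>cube r)
      = (\<integral>\<^sup>+x'. ?G t u * G x' * ennreal (riesz_prod H (r + k) (concat_pt r t u) x') \<partial>cube (r + k))"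
      by (rule nn_integral_cube_add[symmetric]) measurable
  qed
  also have "\<dots> = energy H (r + k) G"
    unfolding energy_def by (rule nn_integral_cube_add[symmetric]) measurable
  finally show ?thesis .
qed

text \<open>This is the previous comparison with \<open>r = 0\<close>: all variables are integrated
  out, and the energy of a constant on the empty tuple is its square.\<close>

lemma nn_integral_finite_of_energy_finite:
  assumes "H < 1" and G: "G \<in> borel_measurable (cube n)" and fin: "energy H n G < \<infinity>"
  shows "(\<integral>\<^sup>+t. G t \<partial>cube n) < \<infinity>"
proof -
  let ?c = "\<integral>\<^sup>+t. G t \<partial>cube n"
  have "concat_pt 0 t u = u" for t u by (simp add: concat_pt_def)
  then have "energy H 0 (\<lambda>t. ?c) \<le> energy H n G"
    using energy_nn_integral_le[OF \<open>H < 1\<close>, of G 0 n] G by simp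
  moreover have "energy H 0 (\<lambda>t. ?c) = ?c * ?c"
    by (simp add: energy_def riesz_prod_def cube.emeasure_space_1)
  ultimately have "?c * ?c < \<infinity>" using fin by simp
  then show ?thesis using ennreal_mult_less_top[of ?c ?c] by auto
qed

section \<open>Traces\<close>

text \<open>The trace of the absolute value of \<open>f\<close> with values in
  \<open>[0, \<infinity>]\<close>, available before any convergence is known.\<close>

definition abs_trace :: "real \<Rightarrow> nat \<Rightarrow> ((nat \<Rightarrow> real) \<Rightarrow> real) \<Rightarrow> (nat \<Rightarrow> real) \<Rightarrow> ennreal" where
  "abs_trace H j f t = (\<integral>\<^sup>+s. ennreal (\<bar>f (concat_pt (2 * j) s t)\<bar> * trace_kernel H j s) \<partial>cube (2 * j))"

lemma Tr_integrand_eq: "Tr_integrand H j f t s = f (concat_pt (2 * j) s t) * trace_kernel H j s"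
  by (simp add: Tr_integrand_def trace_kernel_def)

lemma measurable_abs_trace:
  assumes [measurable]: "f \<in> borel_measurable (cube (2 * j + r))"
  shows "abs_trace H j f \<in> borel_measurable (cube r)"
  unfolding abs_trace_def by measurable

lemma measurable_Tr:
  assumes [measurable]: "f \<in> borel_measurable (cube (2 * j + r))"
  shows "Tr H j f \<in> borel_measurable (cube r)"
  unfolding Tr_def Tr_integrand_eq by measurable

text \<open>In the non-integrable case the Bochner integral on the left is \<open>0\<close>.\<close>

lemma abs_integral_le_nn_integral: "ennreal \<bar>\<integral>x. f x \<partial>M\<bar> \<le> (\<integral>\<^sup>+x. ennreal \<bar>f x :: real\<bar> \<partial>M)"
  using integral_norm_bound_ennreal[of M f] by (cases "integrable M f") (simp_all add: not_integrable_integral_eq)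

lemma abs_Tr_le_abs_trace: "ennreal \<bar>Tr H j f t\<bar> \<le> abs_trace H j f t"
  using abs_integral_le_nn_integral[of "cube (2 * j)" "Tr_integrand H j f t"]
  by (simp add: Tr_def abs_trace_def Tr_integrand_eq abs_mult trace_kernel_nonneg)

text \<open>The source of all finiteness below. With both traces written out, the energy is an
  integral over \<open>2 * r + 4 * j\<close> variables, dominated by gap weights of exponent
  \<open>\<beta> + (2 - 2 * H) < 1\<close>.\<close>

lemma energy_abs_trace_gap_prod_finite:
  assumes "0 \<le> \<beta>" "H < 1" "\<beta> + (2 - 2 * H) < 1"
  shows "energy H r (abs_trace H j (\<lambda>t. c * gap_prod \<beta> (2 * j + r) t)) < \<infinity>"
proof -
  define I where "I = {..<(r + r) + (2 * j + 2 * j)}"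
  define h where "h x = ennreal (\<Prod>a\<in>I. gap_weight (\<beta> + (2 - 2 * H)) I x a)" for x
  define F where "F z s = \<bar>c\<bar> * gap_prod \<beta> (2 * j + r) (concat_pt (2 * j) s z) * trace_kernel H j s" for z s
  have F0: "0 \<le> F z s" for z s unfolding F_def by (simp add: gap_prod_nonneg trace_kernel_nonneg)
  note borel_measurable_gap_prod[measurable]
  have F_meas: "(\<lambda>s. ennreal (F z s)) \<in> borel_measurable (cube (2 * j))" if [measurable]: "z \<in> space (cube r)" for z
    unfolding F_def by measurable
  have h_meas: "h \<in> borel_measurable (cube ((r + r) + (2 * j + 2 * j)))"
    unfolding h_def cube_eq I_def
    by (intro measurable_compose[OF _ measurable_ennreal] borel_measurable_prod borel_measurable_gap_weight) auto
  note h_meas[measurable]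
  let ?x = "\<lambda>z z' s s'. concat_pt (r + r) (concat_pt r z z') (concat_pt (2 * j) s s')"
  have le: "F z s * F z' s' * riesz_prod H r z z' \<le> c\<^sup>2 * (\<Prod>a\<in>I. gap_weight (\<beta> + (2 - 2 * H)) I (?x z z' s s') a)" for z z' s s'
  proof -
    have exp: "2 * H - 2 = - (2 - 2 * H)" by simp
    let ?P = "gap_prod \<beta> (2 * j + r) (concat_pt (2 * j) s z) * trace_kernel H j s *
      (gap_prod \<beta> (2 * j + r) (concat_pt (2 * j) s' z') * trace_kernel H j s') * riesz_prod H r z z'"
    have "?P \<le> (\<Prod>a\<in>I. gap_weight (\<beta> + (2 - 2 * H)) I (?x z z' s s') a)"
      unfolding I_def trace_kernel_def riesz_prod_def exp using assms
      by (intro trace_integrand_le_gap_weights) auto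
    then have "c\<^sup>2 * ?P \<le> c\<^sup>2 * (\<Prod>a\<in>I. gap_weight (\<beta> + (2 - 2 * H)) I (?x z z' s s') a)"
      by (rule mult_left_mono) simp
    moreover have "F z s * F z' s' * riesz_prod H r z z' = c\<^sup>2 * ?P"
      unfolding F_def by (simp add: power2_eq_square mult_ac)
    ultimately show ?thesis by (simp only:)
  qed
  have "energy H r (abs_trace H j (\<lambda>t. c * gap_prod \<beta> (2 * j + r) t))
      = (\<integral>\<^sup>+z. \<integral>\<^sup>+z'. (\<integral>\<^sup>+s. ennreal (F z s) \<partial>cube (2 * j)) * (\<integral>\<^sup>+s'. ennreal (F z' s') \<partial>cube (2 * j)) *
          ennreal (riesz_prod H r z z') \<partial>cube r \<partial>cube r)"
    by (simp add: energy_def abs_trace_def F_def abs_mult gap_prod_nonneg)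
  also have "\<dots> = (\<integral>\<^sup>+z. \<integral>\<^sup>+z'. \<integral>\<^sup>+s. \<integral>\<^sup>+s'. ennreal (F z s * F z' s' * riesz_prod H r z z')
       \<partial>cube (2 * j) \<partial>cube (2 * j) \<partial>cube r \<partial>cube r)"
  proof (intro nn_integral_cong)
    fix z z' assume z: "z \<in> space (cube r)" "z' \<in> space (cube r)"
    note F = F_meas[OF z(1)] F_meas[OF z(2)]
    have "(\<integral>\<^sup>+s'. ennreal (F z s * F z' s' * riesz_prod H r z z') \<partial>cube (2 * j))
        = ennreal (F z s) * ((\<integral>\<^sup>+s'. ennreal (F z' s') \<partial>cube (2 * j)) * ennreal (riesz_prod H r z z'))" for s
    proof -
      have "(\<integral>\<^sup>+s'. ennreal (F z s * F z' s' * riesz_prod H r z z') \<partial>cube (2 * j))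
          = (\<integral>\<^sup>+s'. ennreal (F z s * riesz_prod H r z z') * ennreal (F z' s') \<partial>cube (2 * j))"
        by (simp add: ennreal_mult'[symmetric] F0 riesz_prod_nonneg mult_ac)
      then show ?thesis
        by (simp only: nn_integral_cmult[OF F(2)]) (simp add: ennreal_mult F0 riesz_prod_nonneg mult_ac)
    qed
    then show "(\<integral>\<^sup>+s. ennreal (F z s) \<partial>cube (2 * j)) * (\<integral>\<^sup>+s'. ennreal (F z' s') \<partial>cube (2 * j)) * ennreal (riesz_prod H r z z')
      = (\<integral>\<^sup>+s. \<integral>\<^sup>+s'. ennreal (F z s * F z' s' * riesz_prod H r z z') \<partial>cube (2 * j) \<partial>cube (2 * j))"
      by (simp only: nn_integral_multc[OF F(1)] mult.assoc)
  qed
  also have "\<dots> \<le> (\<integral>\<^sup>+z. \<integral>\<^sup>+z'. \<integral>\<^sup>+s. \<integral>\<^sup>+s'. ennreal (c\<^sup>2) * h (?x z z' s s')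
       \<partial>cube (2 * j) \<partial>cube (2 * j) \<partial>cube r \<partial>cube r)"
    using le by (intro nn_integral_mono)
      (simp add: h_def ennreal_mult'[symmetric] ennreal_leI)
  \<comment> \<open>The nested integrals are merged into one, in the order in which the large tuple
    lists its coordinates.\<close>
  also have "\<dots> = (\<integral>\<^sup>+z. \<integral>\<^sup>+z'. \<integral>\<^sup>+y. ennreal (c\<^sup>2) * h (concat_pt (r + r) (concat_pt r z z') y)
       \<partial>cube (2 * j + 2 * j) \<partial>cube r \<partial>cube r)"
  proof (intro nn_integral_cong)
    fix z z' assume [measurable]: "z \<in> space (cube r)" "z' \<in> space (cube r)"
    show "(\<integral>\<^sup>+s. \<integral>\<^sup>+s'. ennreal (c\<^sup>2) * h (?x z z' s s') \<partial>cube (2 * j) \<partial>cube (2 * j))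
      = (\<integral>\<^sup>+y. ennreal (c\<^sup>2) * h (concat_pt (r + r) (concat_pt r z z') y) \<partial>cube (2 * j + 2 * j))"
      by (rule nn_integral_cube_add[symmetric]) measurable
  qed
  also have "\<dots> = (\<integral>\<^sup>+w. \<integral>\<^sup>+y. ennreal (c\<^sup>2) * h (concat_pt (r + r) w y) \<partial>cube (2 * j + 2 * j) \<partial>cube (r + r))"
    by (rule nn_integral_cube_add[symmetric]) measurable
  also have "\<dots> = (\<integral>\<^sup>+x. ennreal (c\<^sup>2) * h x \<partial>cube ((r + r) + (2 * j + 2 * j)))"
    by (rule nn_integral_cube_add[symmetric]) measurable
  also have "\<dots> = ennreal (c\<^sup>2) * (\<integral>\<^sup>+x. h x \<partial>cube ((r + r) + (2 * j + 2 * j)))"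
    using h_meas by (rule nn_integral_cmult)
  finally have *: "energy H r (abs_trace H j (\<lambda>t. c * gap_prod \<beta> (2 * j + r) t))
      \<le> ennreal (c\<^sup>2) * (\<integral>\<^sup>+x. h x \<partial>cube ((r + r) + (2 * j + 2 * j)))" .
  have "(\<integral>\<^sup>+x. h x \<partial>cube ((r + r) + (2 * j + 2 * j))) < \<infinity>"
    unfolding h_def cube_eq I_def using assms by (intro nn_integral_prod_gap_weight_finite) auto
  then have "ennreal (c\<^sup>2) * (\<integral>\<^sup>+x. h x \<partial>cube ((r + r) + (2 * j + 2 * j))) < \<infinity>"
    by (simp only: ennreal_mult_less_top infinity_ennreal_def) simp
  with * show ?thesis by (rule le_less_trans)
qed

section \<open>Traces of functions whose last variables are integrated out\<close>

definition partial_integral :: "nat \<Rightarrow> nat \<Rightarrow> ((nat \<Rightarrow> real) \<Rightarrow> real) \<Rightarrow> (nat \<Rightarrow> real) \<Rightarrow> real" where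
  "partial_integral m k f t = (\<integral>u. f (concat_pt m t u) \<partial>cube k)"

text \<open>Trace variables come first and integrated variables last, so the two groups can be split
  off in either order.\<close>

lemma concat_pt_assoc: "concat_pt (p + r) (concat_pt p s t) u = concat_pt p s (concat_pt r t u)"
  by (auto simp: concat_pt_def fun_eq_iff)

lemma measurable_partial_integral:
  assumes [measurable]: "f \<in> borel_measurable (cube (m + k))"
  shows "partial_integral m k f \<in> borel_measurable (cube m)"
  unfolding partial_integral_def by measurable

text \<open>Finite energy gives integrability on the whole cube, hence integrability of almost every
  section.\<close>

lemma AE_integrable_section:
  assumes "H < 1" and [measurable]: "f \<in> borel_measurable (cube (m + k))"
    and fin: "energy H (m + k) (\<lambda>t. ennreal \<bar>f t\<bar>) < \<infinity>"
  shows "AE t in cube m. integrable (cube k) (\<lambda>u. f (concat_pt m t u))"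
proof -
  have "(\<integral>\<^sup>+t. \<integral>\<^sup>+u. ennreal \<bar>f (concat_pt m t u)\<bar> \<partial>cube k \<partial>cube m) = (\<integral>\<^sup>+x. ennreal \<bar>f x\<bar> \<partial>cube (m + k))"
    by (rule nn_integral_cube_add[symmetric]) measurable
  also have "\<dots> < \<infinity>" using fin by (intro nn_integral_finite_of_energy_finite[OF \<open>H < 1\<close>]) measurable
  finally have "AE t in cube m. (\<integral>\<^sup>+u. ennreal \<bar>f (concat_pt m t u)\<bar> \<partial>cube k) \<noteq> \<infinity>"
    by (intro nn_integral_noteq_infinite) auto
  moreover have "AE t in cube m. t \<in> space (cube m)" by (rule AE_space)
  ultimately show ?thesis
  proof eventually_elim
    case (elim t)
    then have [measurable]: "t \<in> space (cube m)" by simp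
    show ?case using elim by (intro integrableI_bounded) (measurable, simp add: less_top)
  qed
qed

text \<open>Fubini's theorem in the trace variables \<open>s\<close> and the integrated variables
  \<open>u\<close>, for almost every \<open>t\<close>. Absolute integrability holds because finite
  energy makes \<open>abs_trace\<close> integrable over the cube.\<close>

lemma AE_Tr_partial_integral:
  assumes "H < 1" and f[measurable]: "f \<in> borel_measurable (cube (2 * j + (r + k)))"
    and fin: "energy H (r + k) (abs_trace H j f) < \<infinity>"
  shows "AE t in cube r. integrable (cube (2 * j)) (Tr_integrand H j (partial_integral (2 * j + r) k f) t) \<and>
    Tr H j (partial_integral (2 * j + r) k f) t = (\<integral>u. Tr H j f (concat_pt r t u) \<partial>cube k)"
proof -
  have am: "abs_trace H j f \<in> borel_measurable (cube (r + k))" by (rule measurable_abs_trace) fact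
  note [measurable] = am
  have "(\<integral>\<^sup>+t. \<integral>\<^sup>+u. abs_trace H j f (concat_pt r t u) \<partial>cube k \<partial>cube r) = (\<integral>\<^sup>+x. abs_trace H j f x \<partial>cube (r + k))"
    by (rule nn_integral_cube_add[symmetric]) fact
  also have "\<dots> < \<infinity>" using fin by (intro nn_integral_finite_of_energy_finite[OF \<open>H < 1\<close>] am)
  finally have "AE t in cube r. (\<integral>\<^sup>+u. abs_trace H j f (concat_pt r t u) \<partial>cube k) \<noteq> \<infinity>"
    by (intro nn_integral_noteq_infinite) auto
  moreover have "AE t in cube r. t \<in> space (cube r)" by (rule AE_space)
  ultimately show ?thesis
  proof eventually_elim
    case (elim t)
    then have t[measurable]: "t \<in> space (cube r)" by simp
    define F where "F s u = f (concat_pt (2 * j) s (concat_pt r t u)) * trace_kernel H j s" for s u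
    have F_meas[measurable]: "case_prod F \<in> borel_measurable (cube (2 * j) \<Otimes>\<^sub>M cube k)"
      unfolding F_def by measurable
    have "(\<integral>\<^sup>+z. ennreal (norm (case_prod F z)) \<partial>(cube (2 * j) \<Otimes>\<^sub>M cube k))
        = (\<integral>\<^sup>+u. \<integral>\<^sup>+s. ennreal (norm (F s u)) \<partial>cube (2 * j) \<partial>cube k)"
      by (subst cube_pair.nn_integral_snd[symmetric]) simp_all
    also have "\<dots> = (\<integral>\<^sup>+u. abs_trace H j f (concat_pt r t u) \<partial>cube k)"
      by (simp add: abs_trace_def F_def abs_mult trace_kernel_nonneg)
    also have "\<dots> < \<infinity>" using elim by (simp add: less_top)
    finally have int: "integrable (cube (2 * j) \<Otimes>\<^sub>M cube k) (case_prod F)"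
      by (intro integrableI_bounded F_meas)
    have inner: "Tr_integrand H j (partial_integral (2 * j + r) k f) t s = (\<integral>u. F s u \<partial>cube k)" for s
      by (simp add: Tr_integrand_eq partial_integral_def F_def concat_pt_assoc)
    have outer: "Tr H j f (concat_pt r t u) = (\<integral>s. F s u \<partial>cube (2 * j))" for u
      by (simp add: Tr_def Tr_integrand_eq F_def)
    show ?case
      unfolding outer Tr_def[of H j "partial_integral (2 * j + r) k f"] inner
      using cube_pair.integrable_fst[OF int] cube_pair.Fubini_integral[OF int] inner by presburger
  qed
qed

text \<open>The absolute value moves inside the integral over \<open>u\<close>, which
  \<open>energy_nn_integral_le\<close> then absorbs.\<close>

lemma absH_norm_sq_Tr_partial_integral_le:
  assumes "H < 1" and f: "f \<in> borel_measurable (cube (2 * j + (r + k)))"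
    and fin: "energy H (r + k) (abs_trace H j f) < \<infinity>"
  shows "absH_norm_sq H r (Tr H j (partial_integral (2 * j + r) k f)) \<le> absH_norm_sq H (r + k) (Tr H j f)"
proof -
  have f': "f \<in> borel_measurable (cube ((2 * j + r) + k))" using f by (simp add: add.assoc)
  have Tf[measurable]: "Tr H j f \<in> borel_measurable (cube (r + k))" by (rule measurable_Tr) fact
  have "absH_norm_sq H r (Tr H j (partial_integral (2 * j + r) k f))
      = energy H r (\<lambda>t. ennreal \<bar>Tr H j (partial_integral (2 * j + r) k f) t\<bar>)"
    by (intro absH_norm_sq_eq_energy measurable_Tr measurable_partial_integral f')
  also have "\<dots> \<le> energy H r (\<lambda>t. \<integral>\<^sup>+u. ennreal \<bar>Tr H j f (concat_pt r t u)\<bar> \<partial>cube k)"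
    using AE_Tr_partial_integral[OF assms]
    by (intro energy_mono_AE, eventually_elim) (simp add: abs_integral_le_nn_integral)
  also have "\<dots> \<le> energy H (r + k) (\<lambda>t. ennreal \<bar>Tr H j f t\<bar>)"
    using energy_nn_integral_le[OF \<open>H < 1\<close>, of "\<lambda>t. ennreal \<bar>Tr H j f t\<bar>" r k] by simp
  also have "\<dots> = absH_norm_sq H (r + k) (Tr H j f)"
    by (rule absH_norm_sq_eq_energy[symmetric]) fact
  finally show ?thesis .
qed

theorem lemma4p1:
  fixes H \<alpha> :: real and L :: "real \<Rightarrow> real"
    and M :: "'w measure" and \<tau> :: "'w \<Rightarrow> nat" and m k j :: nat
  assumes "prob_space M"
    and "\<tau> \<in> measurable M (count_space UNIV)"
    and "\<forall>\<omega>\<in>space M. 1 \<le> \<tau> \<omega>"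
    and "\<forall>t>0. 0 < L t"
    and "slowly_varying L"
    and "\<forall>n\<ge>1. measure M {\<omega> \<in> space M. \<tau> \<omega> = n} = L (real n) / real n powr (1 + \<alpha>)"
    and "1 / 2 < H" and "H < 1" and "0 < \<alpha>" and "2 < \<alpha> + 2 * H"
    and "j \<le> m div 2"
  shows "psi_converges H \<alpha> M \<tau> m k
    \<and> Tr_converges H m j (psi H \<alpha> M \<tau> m k)
    \<and> Tr H j (psi H \<alpha> M \<tau> m k) \<in> absH H (m - 2 * j)
    \<and> absH_norm_sq H (m - 2 * j) (Tr H j (psi H \<alpha> M \<tau> m k))
        \<le> absH_norm_sq H (m + k - 2 * j) (Tr H j (phi H \<alpha> M \<tau> (m + k)))"
proof -
  define r where "r = m - 2 * j"
  have m: "m = 2 * j + r" and mk: "m + k - 2 * j = r + k" "m + k = 2 * j + (r + k)"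
    using assms(11) by (auto simp: r_def)
  define f where "f = phi H \<alpha> M \<tau> (m + k)"
  obtain \<beta> and c :: "nat \<Rightarrow> real" where \<beta>: "0 \<le> \<beta>" "\<beta> + (2 - 2 * H) < 1"
    and phi: "\<And>n t. phi H \<alpha> M \<tau> n t = c n * gap_prod \<beta> n t"
    using phi_eq_gap_prod[OF assms(7,8,10), of M \<tau>] by blast
  have f_eq: "f = (\<lambda>t. c (m + k) * gap_prod \<beta> (m + k) t)"
    by (simp add: f_def phi fun_eq_iff)
  have f_meas: "f \<in> borel_measurable (cube (m + k))"
    unfolding f_eq by (intro borel_measurable_times borel_measurable_const borel_measurable_gap_prod)
  have psi: "psi H \<alpha> M \<tau> m k = partial_integral m k f"
    by (simp add: psi_def partial_integral_def f_def fun_eq_iff)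
  have fin: "energy H (r + k) (abs_trace H j f) < \<infinity>"
    using energy_abs_trace_gap_prod_finite[OF \<beta>(1) assms(8) \<beta>(2), of "r + k" j "c (m + k)"]
    by (simp add: f_eq mk)
  \<comment> \<open>The trace of order zero is the function itself, so the estimate with
    \<open>j = 0\<close> gives \<open>phi\<close> finite energy and hence the convergence of
    \<open>psi\<close>.\<close>
  have "abs_trace H 0 f = (\<lambda>t. ennreal \<bar>f t\<bar>)"
    by (simp add: abs_trace_def trace_kernel_def concat_pt_def cube.emeasure_space_1 fun_eq_iff)
  moreover have "energy H (m + k) (abs_trace H 0 f) < \<infinity>"
    using energy_abs_trace_gap_prod_finite[OF \<beta>(1) assms(8) \<beta>(2), of "m + k" 0 "c (m + k)"]
    by (simp add: f_eq)
  ultimately have fin0: "energy H (m + k) (\<lambda>t. ennreal \<bar>f t\<bar>) < \<infinity>"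
    by simp
  have f_meas': "f \<in> borel_measurable (cube (2 * j + (r + k)))"
    using f_meas by (simp only: mk(2))
  have le: "absH_norm_sq H r (Tr H j (partial_integral m k f)) \<le> absH_norm_sq H (r + k) (Tr H j f)"
    using absH_norm_sq_Tr_partial_integral_le[OF assms(8) f_meas' fin] by (simp add: m)
  \<comment> \<open>The norm inequality is continued to a finite bound, which yields membership in
    \<open>absH\<close>.\<close>
  also have "\<dots> = energy H (r + k) (\<lambda>t. ennreal \<bar>Tr H j f t\<bar>)"
    by (intro absH_norm_sq_eq_energy measurable_Tr f_meas')
  also have "\<dots> \<le> energy H (r + k) (abs_trace H j f)"
    by (intro energy_mono_AE AE_I2 abs_Tr_le_abs_trace)
  also note fin
  finally have "absH_norm_sq H r (Tr H j (partial_integral m k f)) < \<infinity>" .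
  moreover have "Tr H j (partial_integral m k f) \<in> borel_measurable (cube r)"
    using measurable_partial_integral[OF f_meas] by (intro measurable_Tr) (simp add: m)
  ultimately have "Tr H j (partial_integral m k f) \<in> absH H r"
    by (simp add: absH_def)
  moreover have "psi_converges H \<alpha> M \<tau> m k"
    using AE_integrable_section[OF assms(8) f_meas fin0] by (simp add: psi_converges_def f_def)
  moreover have "Tr_converges H m j (partial_integral m k f)"
    using AE_Tr_partial_integral[OF assms(8) f_meas' fin]
    unfolding Tr_converges_def r_def[symmetric] by (simp add: m)
  ultimately show ?thesis
    using le by (simp add: psi mk(1) r_def[symmetric] f_def[symmetric])
qed

end
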